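(* Consider the linear system $\dot x(t)=Ax(t)+Bu(t)$ with constraints $(x(t),u(t))\in\mathcal{E}$ and $u(t)\in U$, suppose (A4) and (A5) hold, and let the stage cost be the quadratic form $\ell(x,u)=x^TQx+2x^TSu+u^TRu$ with symmetric positive definite block matrix $\begin{pmatrix}Q&S\\S^T&R\end{pmatrix}$. Then for every $\lambda\in[0,1)$ there exists a constant $M(\lambda)<\infty$ such that $V_\infty(x)\le M(\lambda)$ for all $x\in\lambda\mathcal{A}$. (A4): the pair $(A,B)$ is stabilisable. (A5): the sets $U\subset\mathbb{R}^m$ and $\mathcal{E}:=\{(x,u): g(x,u)\le0\}$, with $g\in\mathcal{C}^2(\mathbb{R}^n\times\mathbb{R}^m,\mathbb{R}^p)$, are convex, compact, and contain the origin in their interior, and each map $u\mapsto g_i(x,u)$ is convex.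
   Context: $A\in\mathbb{R}^{n\times n}$, $B\in\mathbb{R}^{n\times m}$; $x(t;x_0,u)$ denotes the solution with $x(0)=x_0$ under $u\in L^\infty_{\mathrm{loc}}(\mathbb{R}_{\ge0},\mathbb{R}^m)$. $\mathcal{U}_\infty(x_0)$ is the set of such $u$ with $(x(t;x_0,u),u(t))\in\mathcal{E}$ and $u(t)\in U$ for all $t\ge0$. The viability kernel is $\mathcal{A}:=\{x_0:\mathcal{U}_\infty(x_0)\neq\emptyset\}$ and $\lambda\mathcal{A}:=\{\lambda x: x\in\mathcal{A}\}$. $V_\infty(x_0):=\inf_{u\in\mathcal{U}_\infty(x_0)}\int_0^\infty\ell(x(s;x_0,u),u(s))\,\mathrm{d}s$ ($=+\infty$ if $\mathcal{U}_\infty(x_0)=\emptyset$). *)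

theory Defs
  imports "HOL-Analysis.Analysis"
begin

text \<open>Linear control system  x' = A x + B u, state in real^'n, input in real^'m.\<close>

text \<open>Locally essentially bounded measurable inputs on [0,oo).\<close>
definition Linf_loc :: "(real \<Rightarrow> 'a::euclidean_space) \<Rightarrow> bool" where
  "Linf_loc u \<longleftrightarrow> u \<in> borel_measurable (restrict_space lborel {0..}) \<and>
     (\<forall>T\<ge>0. \<exists>C. AE t in lborel. t \<in> {0..T} \<longrightarrow> norm (u t) \<le> C)"

text \<open>(Caratheodory) solution x(.;x0,u) on [0,oo):
  x t = x0 + \<integral>_0^t (A x s + B u s) ds for all t \<ge> 0.\<close>
definition is_traj ::
  "real^'n^'n \<Rightarrow> real^'m^'n \<Rightarrow> real^'n \<Rightarrow> (real \<Rightarrow> real^'m) \<Rightarrow> (real \<Rightarrow> real^'n) \<Rightarrow> bool" where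
  "is_traj A B x0 u x \<longleftrightarrow>
     (\<forall>t\<ge>0. ((\<lambda>s. A *v x s + B *v u s) has_integral (x t - x0)) {0..t})"

definition adm_controls ::
  "real^'n^'n \<Rightarrow> real^'m^'n \<Rightarrow> ((real^'n) \<times> (real^'m)) set \<Rightarrow> (real^'m) set
    \<Rightarrow> real^'n \<Rightarrow> (real \<Rightarrow> real^'m) set" where
  "adm_controls A B E U x0 = {u. Linf_loc u \<and> (\<exists>x. is_traj A B x0 u x \<and>
      (\<forall>t\<ge>0. (x t, u t) \<in> E \<and> u t \<in> U))}"

definition viab_kernel ::
  "real^'n^'n \<Rightarrow> real^'m^'n \<Rightarrow> ((real^'n) \<times> (real^'m)) set \<Rightarrow> (real^'m) set \<Rightarrow> (real^'n) set" where
  "viab_kernel A B E U = {x0. adm_controls A B E U x0 \<noteq> {}}"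

text \<open>Infinite-horizon value function (Inf {} = \<infinity>).\<close>
definition V_inf ::
  "real^'n^'n \<Rightarrow> real^'m^'n \<Rightarrow> ((real^'n) \<times> (real^'m)) set \<Rightarrow> (real^'m) set
    \<Rightarrow> (real^'n \<Rightarrow> real^'m \<Rightarrow> real) \<Rightarrow> real^'n \<Rightarrow> ennreal" where
  "V_inf A B E U ell x0 = Inf {(\<integral>\<^sup>+ s. indicator {0..} s * ennreal (ell (x s) (u s)) \<partial>lborel) | u x.
      u \<in> adm_controls A B E U x0 \<and> is_traj A B x0 u x}"

text \<open>Complexification of a real matrix, used for eigenvalues.\<close>
definition cmat :: "real^'n^'n \<Rightarrow> complex^'n^'n" where
  "cmat M = (\<chi> i j. complex_of_real (M $ i $ j))"

text \<open>(A,B) stabilisable: some feedback K makes A + B K Hurwitz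
  (all complex eigenvalues have negative real part).\<close>
definition stabilisable :: "real^'n^'n \<Rightarrow> real^'m^'n \<Rightarrow> bool" where
  "stabilisable A B \<longleftrightarrow> (\<exists>K :: real^'n^'m. \<forall>(\<mu>::complex) (v::complex^'n).
      v \<noteq> 0 \<and> cmat (A + B ** K) *v v = \<mu> *s v \<longrightarrow> Re \<mu> < 0)"

text \<open>g is of class C^2 on the whole space.\<close>
definition C2 :: "('a::real_normed_vector \<Rightarrow> 'b::real_normed_vector) \<Rightarrow> bool" where
  "C2 g \<longleftrightarrow> (\<exists>g' g''. (\<forall>z. (g has_derivative blinfun_apply (g' z)) (at z)) \<and>
      (\<forall>z. (g' has_derivative blinfun_apply (g'' z)) (at z)) \<and> continuous_on UNIV g'')"

end

theory Submission
  imports Defs "Jordan_Normal_Form.Schur_Decomposition"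
begin

text \<open>
  Let \<open>y\<close> lie in the viability kernel with admissible pair \<open>(x\<^sub>y, u\<^sub>y)\<close>, and let the feedback
  \<open>K\<close> make \<open>A + B K\<close> Hurwitz. On the periods \<open>[k T, (k + 1) T)\<close> the state \<open>\<lambda> y\<close> is steered by
  \<open>x = a\<^sub>k x\<^sub>y + z\<close> and \<open>u = a\<^sub>k u\<^sub>y + K z\<close>, where the weights \<open>a\<^sub>k = \<lambda> \<rho>\<^sup>k\<close> decrease
  geometrically and \<open>z\<close> follows the closed loop \<open>z' = (A + B K) z\<close>; at the end of each period the
  drop \<open>(a\<^sub>k - a\<^sub>k\<^sub>+\<^sub>1) x\<^sub>y\<close> of the weighted part is added to \<open>z\<close>, so \<open>x\<close> stays continuous.
  If the closed-loop flow halves every vector over one period and \<open>\<rho>\<close> is close to 1, then \<open>z\<close>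
  stays small compared to \<open>1 - a\<^sub>k \<ge> 1 - \<lambda>\<close>. Hence \<open>(x, u)\<close> is a convex combination of
  \<open>(x\<^sub>y, u\<^sub>y)\<close> and a point of a ball around the origin inside \<open>E\<close> (and \<open>U\<close>), so it is
  admissible, and \<open>|x|, |u| \<le> c \<rho>\<^sup>k\<close> on the \<open>k\<close>-th period with \<open>c\<close> independent of \<open>y\<close>.
  The cost is then bounded by a geometric series.

  The decay of the closed-loop flow comes from a Schur triangularisation of \<open>A + B K\<close>: after
  conjugation with \<open>diag (\<epsilon>\<^sup>-\<^sup>i)\<close> the off-diagonal part is small, so the squared norm in these
  coordinates is a Lyapunov function.
\<close>

section \<open>The flow of a linear system as a power series\<close>

definition linear_flow :: "real^'n^'n \<Rightarrow> real \<Rightarrow> real^'n \<Rightarrow> real^'n" where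
  "linear_flow M t v = (\<Sum>k. (t ^ k / fact k) *\<^sub>R ((*v) M ^^ k) v)"

lemma norm_funpow_matrix_vector_le:
  fixes M :: "real^'n^'n"
  shows "norm (((*v) M ^^ k) v) \<le> onorm ((*v) M) ^ k * norm v"
proof (induction k)
  case (Suc k)
  have "norm (M *v ((*v) M ^^ k) v) \<le> onorm ((*v) M) * norm (((*v) M ^^ k) v)"
    by (rule onorm) (rule matrix_vector_mul_bounded_linear)
  also have "\<dots> \<le> onorm ((*v) M) * (onorm ((*v) M) ^ k * norm v)"
    using Suc onorm_pos_le[OF matrix_vector_mul_bounded_linear] by (intro mult_left_mono)
  finally show ?case by simp
qed simp

lemma summable_linear_flow:
  fixes M :: "real^'n^'n"
  shows "summable (\<lambda>k. (t ^ k / fact k) *\<^sub>R ((*v) M ^^ k) v)"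
proof -
  let ?c = "onorm ((*v) M)"
  have bound: "norm (norm ((t ^ k / fact k) *\<^sub>R ((*v) M ^^ k) v)) \<le> norm v * ((\<bar>t\<bar> * ?c) ^ k /\<^sub>R fact k)"
    for k
  proof -
    have "norm (norm ((t ^ k / fact k) *\<^sub>R ((*v) M ^^ k) v))
        = \<bar>t\<bar> ^ k / fact k * norm (((*v) M ^^ k) v)"
      by (simp add: power_abs)
    also have "\<dots> \<le> \<bar>t\<bar> ^ k / fact k * (?c ^ k * norm v)"
      by (intro mult_left_mono norm_funpow_matrix_vector_le) auto
    also have "\<dots> = norm v * ((\<bar>t\<bar> * ?c) ^ k /\<^sub>R fact k)"
      by (simp add: power_mult_distrib divide_inverse mult_ac)
    finally show ?thesis .
  qed
  have major: "summable (\<lambda>k. norm v * ((\<bar>t\<bar> * ?c) ^ k /\<^sub>R fact k))"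
    by (intro summable_mult summable_exp_generic)
  show ?thesis
    by (rule summable_norm_cancel[OF summable_comparison_test[OF _ major]]) (use bound in blast)
qed

lemma linear_flow_sums_bounded_linear:
  fixes M :: "real^'n^'n"
  assumes "bounded_linear f"
  shows "(\<lambda>k. (t ^ k / fact k) *\<^sub>R f (((*v) M ^^ k) v)) sums f (linear_flow M t v)"
  using bounded_linear.sums[OF assms summable_sums[OF summable_linear_flow]]
  by (simp add: linear_flow_def linear_simps(5)[OF assms])

lemma linear_flow_at_0 [simp]:
  fixes M :: "real^'n^'n"
  shows "linear_flow M 0 v = v"
proof -
  have "(\<lambda>k. (0 ^ k / fact k) *\<^sub>R ((*v) M ^^ k) v) = (\<lambda>k. if k = 0 then ((*v) M ^^ k) v else 0)"
    by auto
  then have "(\<lambda>k. (0 ^ k / fact k) *\<^sub>R ((*v) M ^^ k) v) sums v"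
    using sums_single[of 0 "\<lambda>k. ((*v) M ^^ k) v"] by simp
  then show ?thesis
    by (simp add: linear_flow_def sums_iff)
qed

lemma linear_flow_zero [simp]:
  fixes M :: "real^'n^'n"
  shows "linear_flow M t 0 = 0"
proof -
  have "((*v) M ^^ k) 0 = 0" for k
    by (induction k) simp_all
  then show ?thesis
    by (simp add: linear_flow_def)
qed

lemma linear_flow_has_vector_derivative:
  fixes M :: "real^'n^'n"
  shows "((\<lambda>t. linear_flow M t v) has_vector_derivative M *v linear_flow M t v) (at t within S)"
  unfolding has_vector_derivative_def
proof (subst has_derivative_componentwise_within, intro ballI)
  fix b :: "real^'n" assume "b \<in> Basis"
  then obtain i where b: "b = axis i 1"
    unfolding Basis_vec_def by auto
  define c where "c k = (((*v) M ^^ k) v $ i) / fact k" for k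
  have "(\<lambda>k. c k * t ^ k) sums (linear_flow M t v $ i)" for t
    using linear_flow_sums_bounded_linear[OF bounded_linear_vec_nth, of t M v i]
    by (simp add: c_def field_simps)
  then have flow_nth: "linear_flow M t v $ i = (\<Sum>k. c k * t ^ k)"
    and summable: "summable (\<lambda>k. c k * t ^ k)" for t
    by (simp_all add: sums_iff)
  have "diffs c k * t ^ k = (t ^ k / fact k) *\<^sub>R (M *v ((*v) M ^^ k) v) $ i" for k
  proof -
    have "(fact (Suc k) :: real) = real (Suc k) * fact k"
      by simp
    then have "diffs c k = (M *v ((*v) M ^^ k) v) $ i / fact k"
      unfolding diffs_def c_def by (simp del: of_nat_Suc)
    then show ?thesis
      by simp
  qed
  moreover have "bounded_linear (\<lambda>x. (M *v x) $ i)"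
    by (intro bounded_linear_compose[OF bounded_linear_vec_nth] matrix_vector_mul_bounded_linear)
  from linear_flow_sums_bounded_linear[OF this, where t = t and v = v]
  have "(\<lambda>k. (t ^ k / fact k) *\<^sub>R (M *v ((*v) M ^^ k) v) $ i) sums (M *v linear_flow M t v) $ i"
    by (simp add: matrix_vector_mult_scaleR)
  ultimately have "(\<Sum>k. diffs c k * t ^ k) = (M *v linear_flow M t v) $ i"
    by (simp add: sums_iff)
  then have "((\<lambda>t. linear_flow M t v $ i) has_real_derivative (M *v linear_flow M t v) $ i) (at t)"
    unfolding flow_nth[abs_def]
    using termdiffs_strong_converges_everywhere[OF summable, of t] by simp
  then show "((\<lambda>t. linear_flow M t v \<bullet> b) has_derivative
      (\<lambda>h. h *\<^sub>R (M *v linear_flow M t v) \<bullet> b)) (at t within S)"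
    unfolding b inner_axis has_field_derivative_def
    by (auto simp: mult.commute[of _ "(M *v _) $ i"] intro: has_derivative_at_withinI)
qed

lemma continuous_on_linear_flow:
  fixes M :: "real^'n^'n"
  shows "continuous_on S (\<lambda>t. linear_flow M t v)"
  by (intro continuous_at_imp_continuous_on ballI
      has_vector_derivative_continuous[OF linear_flow_has_vector_derivative])

lemma linear_flow_has_integral:
  fixes M :: "real^'n^'n"
  assumes "c \<le> d"
  shows "((\<lambda>s. M *v linear_flow M (s - c) v) has_integral (linear_flow M (d - c) v - v)) {c..d}"
proof -
  have "((\<lambda>s. s - c) has_vector_derivative 1) (at s within {c..d})" for s
    by (auto intro!: derivative_eq_intros)
  from vector_diff_chain_within[OF this linear_flow_has_vector_derivative]
  have "((\<lambda>s. linear_flow M (s - c) v) has_vector_derivative M *v linear_flow M (s - c) v)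
      (at s within {c..d})" for s
    by (simp add: o_def)
  from fundamental_theorem_of_calculus[OF assms this] show ?thesis
    by simp
qed

section \<open>Quadratic Lyapunov functions of Hurwitz matrices\<close>

lemma similar_upper_triangular_diag_eigenvalue:
  fixes Am Bm :: "complex mat"
  assumes "Am \<in> carrier_mat n n" "Bm \<in> carrier_mat n n" "upper_triangular Bm" "similar_mat Am Bm"
    and "i < n"
  shows "eigenvalue Am (Bm $$ (i, i))"
proof -
  have "Bm $$ (i, i) \<in> set (diag_mat Bm)"
    using assms(2,5) by (auto simp: diag_mat_def)
  then have "poly (char_poly Bm) (Bm $$ (i, i)) = 0"
    unfolding char_poly_upper_triangular[OF assms(2,3)] poly_prod_list
    by (auto simp: prod_list_zero_iff o_def)
  then show ?thesis
    using char_poly_similar[OF assms(4)] eigenvalue_root_char_poly[OF assms(1)] by simp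
qed

lemma index_mult_mat_sum:
  assumes "X \<in> carrier_mat n n" "Y \<in> carrier_mat n n" "i < n" "j < n"
  shows "(X * Y) $$ (i, j) = (\<Sum>k<n. X $$ (i, k) * Y $$ (k, j))"
  using assms by (simp add: scalar_prod_def atLeast0LessThan)

lemma schur_triangularization_nat:
  fixes A :: "nat \<Rightarrow> nat \<Rightarrow> complex"
  obtains B P Q :: "nat \<Rightarrow> nat \<Rightarrow> complex" where
    "\<And>i j. i < n \<Longrightarrow> j < i \<Longrightarrow> B i j = 0"
    "\<And>i j. i < n \<Longrightarrow> j < n \<Longrightarrow> (\<Sum>k<n. P i k * Q k j) = (if i = j then 1 else 0)"
    "\<And>i j. i < n \<Longrightarrow> j < n \<Longrightarrow> (\<Sum>k<n. Q i k * A k j) = (\<Sum>k<n. B i k * Q k j)"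
    "\<And>i. i < n \<Longrightarrow> \<exists>v. (\<exists>j<n. v j \<noteq> 0) \<and> (\<forall>k<n. (\<Sum>j<n. A k j * v j) = B i i * v k)"
proof -
  define Am where "Am = Matrix.mat n n (\<lambda>(i, j). A i j)"
  have Am: "Am \<in> carrier_mat n n"
    by (simp add: Am_def)
  obtain es where "char_poly Am = (\<Prod>a\<leftarrow>es. [:- a, 1:])"
    using char_poly_factorized[OF Am] by blast
  then obtain Bm where Bm: "Bm \<in> carrier_mat n n" "upper_triangular Bm" "similar_mat Am Bm"
    using schur_decomposition_exists[OF Am] by blast
  then obtain n' Pm Qm where PQ: "{Am, Bm, Pm, Qm} \<subseteq> carrier_mat n' n'"
    "Pm * Qm = 1\<^sub>m n'" "Qm * Pm = 1\<^sub>m n'" "Am = Pm * Bm * Qm"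
    using similar_matD by blast
  have "n' = n"
    using PQ(1) Am by auto
  with PQ have Pm: "Pm \<in> carrier_mat n n" and Qm: "Qm \<in> carrier_mat n n"
    and PQ1: "Pm * Qm = 1\<^sub>m n" and QP1: "Qm * Pm = 1\<^sub>m n"
    by auto
  have "Qm * Am = (Qm * Pm) * Bm * Qm"
    using Pm Qm Bm(1) by (simp add: PQ(4) assoc_mult_mat[of _ n n _ n _ n])
  then have QA: "Qm * Am = Bm * Qm"
    using Bm(1) Qm by (simp add: QP1)
  have eigen: "\<exists>v. (\<exists>j<n. v j \<noteq> 0) \<and> (\<forall>k<n. (\<Sum>j<n. A k j * v j) = Bm $$ (i, i) * v k)"
    if i: "i < n" for i
  proof -
    obtain v where v: "v \<in> carrier_vec n" "v \<noteq> 0\<^sub>v n" "Am *\<^sub>v v = Bm $$ (i, i) \<cdot>\<^sub>v v"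
      using similar_upper_triangular_diag_eigenvalue[OF Am Bm i] Am
      unfolding eigenvalue_def eigenvector_def by auto
    have "(\<Sum>j<n. A k j * v $ j) = Bm $$ (i, i) * v $ k" if "k < n" for k
      using arg_cong[OF v(3), of "\<lambda>x. x $ k"] that v(1) by (simp add: Am_def scalar_prod_def atLeast0LessThan)
    moreover have "\<exists>j<n. v $ j \<noteq> 0"
      using v(1,2) by (metis eq_vecI carrier_vecD index_zero_vec(1,2))
    ultimately show ?thesis
      by blast
  qed
  show ?thesis
  proof
    show "Bm $$ (i, j) = 0" if "i < n" "j < i" for i j
      using Bm(1,2) that by (auto simp: upper_triangular_def)
    show "(\<Sum>k<n. Pm $$ (i, k) * Qm $$ (k, j)) = (if i = j then 1 else 0)" if "i < n" "j < n" for i j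
      using index_mult_mat_sum[OF Pm Qm that] that by (simp add: PQ1)
    show "(\<Sum>k<n. Qm $$ (i, k) * A k j) = (\<Sum>k<n. Bm $$ (i, k) * Qm $$ (k, j))" if "i < n" "j < n" for i j
      using index_mult_mat_sum[OF Qm Am that] index_mult_mat_sum[OF Bm(1) Qm that] that
      by (simp add: QA[symmetric] Am_def)
  qed (use eigen in blast)
qed

lemma cmod_mult_le_sum_squares:
  fixes w :: "nat \<Rightarrow> complex"
  assumes "i < n" "j < n"
  shows "cmod (w i) * cmod (w j) \<le> (\<Sum>k<n. (cmod (w k))\<^sup>2)"
proof -
  have "cmod (w i) * cmod (w j) \<le> ((cmod (w i))\<^sup>2 + (cmod (w j))\<^sup>2) / 2"
    using sum_squares_bound[of "cmod (w i)" "cmod (w j)"] by (simp add: power2_eq_square)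
  also have "\<dots> \<le> (\<Sum>k<n. (cmod (w k))\<^sup>2)"
  proof -
    have "(cmod (w i))\<^sup>2 \<le> (\<Sum>k<n. (cmod (w k))\<^sup>2)" "(cmod (w j))\<^sup>2 \<le> (\<Sum>k<n. (cmod (w k))\<^sup>2)"
      using assms by (auto intro!: member_le_sum)
    then show ?thesis
      by (simp add: field_simps)
  qed
  finally show ?thesis .
qed

lemma rescaled_offdiagonal_bound:
  fixes B :: "nat \<Rightarrow> nat \<Rightarrow> complex"
  assumes upper: "\<And>i j. i < n \<Longrightarrow> j < i \<Longrightarrow> B i j = 0" and \<epsilon>: "0 < \<epsilon>" "\<epsilon> \<le> 1"
  shows "cmod (\<Sum>i<n. \<Sum>j<n. if j = i then 0 else cnj (w i) * (B i j * of_real (\<epsilon> ^ (j - i)) * w j))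
    \<le> \<epsilon> * (\<Sum>i<n. \<Sum>j<n. cmod (B i j)) * (\<Sum>i<n. (cmod (w i))\<^sup>2)"
proof -
  define W where "W = (\<Sum>i<n. (cmod (w i))\<^sup>2)"
  have entry: "cmod (if j = i then 0 else cnj (w i) * (B i j * of_real (\<epsilon> ^ (j - i)) * w j))
      \<le> \<epsilon> * W * cmod (B i j)" if ij: "i < n" "j < n" for i j
  proof (cases "i < j")
    case True
    then have "\<epsilon> ^ (j - i) \<le> \<epsilon>"
      using power_decreasing[of 1 "j - i" \<epsilon>] \<epsilon> by simp
    moreover have "cmod (w i) * cmod (w j) \<le> W"
      unfolding W_def using cmod_mult_le_sum_squares ij .
    ultimately have "cmod (B i j) * \<epsilon> ^ (j - i) * (cmod (w i) * cmod (w j)) \<le> cmod (B i j) * \<epsilon> * W"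
      using \<epsilon> by (intro mult_mono) auto
    then show ?thesis
      using True \<epsilon> by (simp add: norm_mult norm_power mult_ac)
  next
    case False
    then show ?thesis
      using upper[of i j] ij \<epsilon> by (cases "i = j") (auto simp: W_def intro!: mult_nonneg_nonneg sum_nonneg)
  qed
  have "cmod (\<Sum>i<n. \<Sum>j<n. if j = i then 0 else cnj (w i) * (B i j * of_real (\<epsilon> ^ (j - i)) * w j))
      \<le> (\<Sum>i<n. \<Sum>j<n. cmod (if j = i then 0 else cnj (w i) * (B i j * of_real (\<epsilon> ^ (j - i)) * w j)))"
    by (rule order_trans[OF norm_sum sum_mono]) (rule norm_sum)
  also have "\<dots> \<le> (\<Sum>i<n. \<Sum>j<n. \<epsilon> * W * cmod (B i j))"
    using entry by (intro sum_mono) auto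
  also have "\<dots> = \<epsilon> * (\<Sum>i<n. \<Sum>j<n. cmod (B i j)) * W"
    by (simp add: sum_distrib_left mult_ac)
  finally show ?thesis
    by (simp only: W_def)
qed

lemma Re_quadratic_form_split_diagonal:
  fixes M :: "nat \<Rightarrow> nat \<Rightarrow> complex"
  shows "Re (\<Sum>i<n. cnj (w i) * (\<Sum>j<n. M i j * w j))
    = (\<Sum>i<n. Re (M i i) * (cmod (w i))\<^sup>2)
      + Re (\<Sum>i<n. \<Sum>j<n. if j = i then 0 else cnj (w i) * (M i j * w j))"
proof -
  define X where "X i j = cnj (w i) * (M i j * w j)" for i j
  have row: "cnj (w i) * (\<Sum>j<n. M i j * w j) = X i i + (\<Sum>j<n. if j = i then 0 else X i j)"
    if "i < n" for i
  proof -
    have "cnj (w i) * (\<Sum>j<n. M i j * w j) = (\<Sum>j<n. X i j)"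
      by (simp add: X_def sum_distrib_left)
    also have "\<dots> = (\<Sum>j<n. (if j = i then X i j else 0) + (if j = i then 0 else X i j))"
      by (intro sum.cong) auto
    finally show ?thesis
      using that by (simp add: sum.distrib)
  qed
  have diag: "Re (X i i) = Re (M i i) * (cmod (w i))\<^sup>2" for i
  proof -
    have "cnj (w i) * w i = of_real ((cmod (w i))\<^sup>2)"
      by (metis complex_norm_square mult.commute)
    then show ?thesis
      by (simp add: X_def mult.left_commute[of "cnj (w i)"])
  qed
  have "(\<Sum>i<n. cnj (w i) * (\<Sum>j<n. M i j * w j)) = (\<Sum>i<n. X i i + (\<Sum>j<n. if j = i then 0 else X i j))"
    by (intro sum.cong refl row) simp
  then have "Re (\<Sum>i<n. cnj (w i) * (\<Sum>j<n. M i j * w j))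
      = Re (\<Sum>i<n. X i i) + Re (\<Sum>i<n. \<Sum>j<n. if j = i then 0 else X i j)"
    by (simp only: sum.distrib plus_complex.sel)
  also have "Re (\<Sum>i<n. X i i) = (\<Sum>i<n. Re (M i i) * (cmod (w i))\<^sup>2)"
    by (simp only: Re_sum diag)
  also have "(\<Sum>i<n. \<Sum>j<n. if j = i then 0 else X i j)
      = (\<Sum>i<n. \<Sum>j<n. if j = i then 0 else cnj (w i) * (M i j * w j))"
    unfolding X_def ..
  finally show ?thesis .
qed

(* Conjugation with diag (\<epsilon>^(-i)) multiplies the entry (i, j) by \<epsilon>^(j - i): the diagonal is kept
   and the strictly upper part becomes small. *)
lemma upper_triangular_rescaled_dissipative:
  fixes B :: "nat \<Rightarrow> nat \<Rightarrow> complex"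
  assumes upper: "\<And>i j. i < n \<Longrightarrow> j < i \<Longrightarrow> B i j = 0"
    and diag: "\<And>i. i < n \<Longrightarrow> Re (B i i) \<le> - sg" and sg: "sg > 0"
  obtains \<epsilon> where "\<epsilon> > 0"
    "\<And>w. Re (\<Sum>i<n. cnj (w i) * (\<Sum>j<n. B i j * of_real (\<epsilon> ^ (j - i)) * w j))
      \<le> - (sg / 2) * (\<Sum>i<n. (cmod (w i))\<^sup>2)"
proof
  define bmax where "bmax = (\<Sum>i<n. \<Sum>j<n. cmod (B i j))"
  have "bmax \<ge> 0"
    unfolding bmax_def by (intro sum_nonneg) auto
  define \<epsilon> where "\<epsilon> = min 1 (sg / (2 * (bmax + 1)))"
  have \<epsilon>: "0 < \<epsilon>" "\<epsilon> \<le> 1"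
    using sg \<open>bmax \<ge> 0\<close> by (auto simp: \<epsilon>_def)
  have "sg / (2 * (bmax + 1)) \<ge> 0"
    using sg \<open>bmax \<ge> 0\<close> by simp
  then have "\<epsilon> * bmax \<le> sg / (2 * (bmax + 1)) * (bmax + 1)"
    using \<open>bmax \<ge> 0\<close> by (intro mult_mono) (auto simp: \<epsilon>_def)
  also have "\<dots> = sg / 2"
    using \<open>bmax \<ge> 0\<close> by (simp add: field_simps)
  finally have \<epsilon>_bmax: "\<epsilon> * bmax \<le> sg / 2" .
  show "\<epsilon> > 0"
    using \<epsilon> by simp
  fix w :: "nat \<Rightarrow> complex"
  define W where "W = (\<Sum>i<n. (cmod (w i))\<^sup>2)"
  define off where "off = (\<Sum>i<n. \<Sum>j<n. if j = i then 0 else cnj (w i) * (B i j * of_real (\<epsilon> ^ (j - i)) * w j))"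
  have "(\<Sum>i<n. Re (B i i) * (cmod (w i))\<^sup>2) \<le> (\<Sum>i<n. - sg * (cmod (w i))\<^sup>2)"
    using diag by (intro sum_mono mult_right_mono) auto
  then have "(\<Sum>i<n. Re (B i i) * (cmod (w i))\<^sup>2) \<le> - sg * W"
    by (simp add: W_def sum_distrib_left)
  moreover have "Re off \<le> \<epsilon> * bmax * W"
    using complex_Re_le_cmod[of off] rescaled_offdiagonal_bound[where n = n and B = B and w = w, OF upper \<epsilon>]
    unfolding off_def bmax_def W_def by linarith
  moreover have "\<epsilon> * bmax * W \<le> sg / 2 * W"
    using \<epsilon>_bmax by (intro mult_right_mono) (auto simp: W_def intro!: sum_nonneg)
  moreover have "Re (\<Sum>i<n. cnj (w i) * (\<Sum>j<n. B i j * of_real (\<epsilon> ^ (j - i)) * w j))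
      = (\<Sum>i<n. Re (B i i) * (cmod (w i))\<^sup>2) + Re off"
    using Re_quadratic_form_split_diagonal[where n = n and w = w and M = "\<lambda>i j. B i j * of_real (\<epsilon> ^ (j - i))"]
    by (simp add: off_def mult.assoc)
  ultimately show "Re (\<Sum>i<n. cnj (w i) * (\<Sum>j<n. B i j * of_real (\<epsilon> ^ (j - i)) * w j))
      \<le> - (sg / 2) * (\<Sum>i<n. (cmod (w i))\<^sup>2)"
    unfolding W_def[symmetric] by linarith
qed

lemma sum_matrix_vector_assoc:
  fixes S A :: "nat \<Rightarrow> nat \<Rightarrow> 'a::comm_semiring_0"
  shows "(\<Sum>j<n. S i j * (\<Sum>l<n. A j l * w l)) = (\<Sum>l<n. (\<Sum>j<n. S i j * A j l) * w l)"
proof -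
  have "(\<Sum>j<n. S i j * (\<Sum>l<n. A j l * w l)) = (\<Sum>j<n. \<Sum>l<n. S i j * A j l * w l)"
    by (simp add: sum_distrib_left mult.assoc)
  also have "\<dots> = (\<Sum>l<n. \<Sum>j<n. S i j * A j l * w l)"
    by (rule sum.swap)
  finally show ?thesis
    by (simp add: sum_distrib_right)
qed

lemma left_inverse_lower_bound:
  fixes S T :: "nat \<Rightarrow> nat \<Rightarrow> complex"
  assumes TS: "\<And>i j. i < n \<Longrightarrow> j < n \<Longrightarrow> (\<Sum>k<n. T i k * S k j) = (if i = j then 1 else 0)"
  shows "\<exists>c>0. \<forall>w. c * (\<Sum>j<n. (cmod (w j))\<^sup>2) \<le> (\<Sum>i<n. (cmod (\<Sum>j<n. S i j * w j))\<^sup>2)"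
proof -
  define t where "t = (\<Sum>j<n. (\<Sum>m<n. cmod (T j m))\<^sup>2)"
  have "t \<ge> 0"
    unfolding t_def by (intro sum_nonneg) auto
  have "1 / (t + 1) * (\<Sum>j<n. (cmod (w j))\<^sup>2) \<le> (\<Sum>i<n. (cmod (\<Sum>j<n. S i j * w j))\<^sup>2)" for w
  proof -
    define V where "V = (\<Sum>i<n. (cmod (\<Sum>j<n. S i j * w j))\<^sup>2)"
    have "V \<ge> 0"
      unfolding V_def by (intro sum_nonneg) auto
    have "cmod (w j) \<le> (\<Sum>m<n. cmod (T j m)) * sqrt V" if j: "j < n" for j
    proof -
      have "(\<Sum>m<n. T j m * (\<Sum>l<n. S m l * w l)) = (\<Sum>l<n. (if j = l then 1 else 0) * w l)"
        using TS[OF j] by (simp add: sum_matrix_vector_assoc)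
      also have "\<dots> = (\<Sum>l<n. if j = l then w l else 0)"
        by (intro sum.cong) auto
      also have "\<dots> = w j"
        using j by simp
      finally have "cmod (w j) \<le> (\<Sum>m<n. cmod (T j m) * cmod (\<Sum>l<n. S m l * w l))"
        by (metis (no_types, lifting) norm_mult norm_sum sum.cong)
      also have "\<dots> \<le> (\<Sum>m<n. cmod (T j m) * sqrt V)"
        unfolding V_def by (intro sum_mono mult_left_mono real_le_rsqrt member_le_sum) auto
      finally show ?thesis
        by (simp add: sum_distrib_right)
    qed
    then have "(cmod (w j))\<^sup>2 \<le> (\<Sum>m<n. cmod (T j m))\<^sup>2 * V" if "j < n" for j
      using that \<open>V \<ge> 0\<close> by (metis norm_ge_zero power_mono power_mult_distrib real_sqrt_pow2)
    then have "(\<Sum>j<n. (cmod (w j))\<^sup>2) \<le> t * V"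
      unfolding t_def sum_distrib_right by (intro sum_mono) auto
    then have "(\<Sum>j<n. (cmod (w j))\<^sup>2) / (t + 1) \<le> V"
      using \<open>t \<ge> 0\<close> \<open>V \<ge> 0\<close> by (simp add: divide_le_eq algebra_simps)
    then show ?thesis
      by (simp add: V_def)
  qed
  then show ?thesis
    using \<open>t \<ge> 0\<close> by (intro exI[of _ "1 / (t + 1)"]) auto
qed

lemma rescaled_similarity:
  fixes A B Q :: "nat \<Rightarrow> nat \<Rightarrow> complex"
  assumes "\<epsilon> > 0" and upper: "\<And>i j. i < n \<Longrightarrow> j < i \<Longrightarrow> B i j = 0"
    and QA: "(\<Sum>k<n. Q i k * A k j) = (\<Sum>k<n. B i k * Q k j)" and "i < n"
  shows "(\<Sum>k<n. of_real ((1 / \<epsilon>) ^ i) * Q i k * A k j)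
    = (\<Sum>k<n. B i k * of_real (\<epsilon> ^ (k - i)) * (of_real ((1 / \<epsilon>) ^ k) * Q k j))"
proof -
  have summand: "B i k * Q k j * of_real ((1 / \<epsilon>) ^ i)
      = B i k * of_real (\<epsilon> ^ (k - i)) * (of_real ((1 / \<epsilon>) ^ k) * Q k j)" for k
  proof (cases "k < i")
    case True
    then show ?thesis
      using upper \<open>i < n\<close> by simp
  next
    case False
    then have "\<epsilon> ^ (k - i) * (1 / \<epsilon>) ^ k = (1 / \<epsilon>) ^ i"
      using \<open>\<epsilon> > 0\<close> by (simp add: power_diff power_one_over field_simps)
    then have "(of_real (\<epsilon> ^ (k - i)) * of_real ((1 / \<epsilon>) ^ k) :: complex) = of_real ((1 / \<epsilon>) ^ i)"
      by (simp only: of_real_mult[symmetric])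
    then show ?thesis
      by (metis mult.commute mult.left_commute)
  qed
  have "(\<Sum>k<n. of_real ((1 / \<epsilon>) ^ i) * Q i k * A k j) = (\<Sum>k<n. B i k * Q k j) * of_real ((1 / \<epsilon>) ^ i)"
    by (simp add: QA[symmetric] sum_distrib_left sum_distrib_right mult_ac)
  also have "\<dots> = (\<Sum>k<n. B i k * Q k j * of_real ((1 / \<epsilon>) ^ i))"
    by (rule sum_distrib_right)
  also have "\<dots> = (\<Sum>k<n. B i k * of_real (\<epsilon> ^ (k - i)) * (of_real ((1 / \<epsilon>) ^ k) * Q k j))"
    by (rule sum.cong[OF refl summand])
  finally show ?thesis .
qed

lemma diagonal_rescaling:
  fixes A B P Q :: "nat \<Rightarrow> nat \<Rightarrow> complex"
  assumes "\<epsilon> > 0" and upper: "\<And>i j. i < n \<Longrightarrow> j < i \<Longrightarrow> B i j = 0"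
    and PQ: "\<And>i j. i < n \<Longrightarrow> j < n \<Longrightarrow> (\<Sum>k<n. P i k * Q k j) = (if i = j then 1 else 0)"
    and QA: "\<And>i j. i < n \<Longrightarrow> j < n \<Longrightarrow> (\<Sum>k<n. Q i k * A k j) = (\<Sum>k<n. B i k * Q k j)"
  defines "S \<equiv> \<lambda>i j. of_real ((1 / \<epsilon>) ^ i) * Q i j"
    and "T \<equiv> \<lambda>i j. P i j * of_real (\<epsilon> ^ j)"
  shows "\<And>i j. i < n \<Longrightarrow> j < n \<Longrightarrow> (\<Sum>k<n. T i k * S k j) = (if i = j then 1 else 0)"
    and "\<And>i w. i < n \<Longrightarrow> (\<Sum>j<n. S i j * (\<Sum>l<n. A j l * w l))
      = (\<Sum>k<n. B i k * of_real (\<epsilon> ^ (k - i)) * (\<Sum>l<n. S k l * w l))"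
proof -
  fix i j assume "i < n" "j < n"
  have "(of_real (\<epsilon> ^ k) * of_real ((1 / \<epsilon>) ^ k) :: complex) = 1" for k
    using \<open>\<epsilon> > 0\<close> by (simp flip: of_real_mult add: power_mult_distrib[symmetric])
  then have "T i k * S k j = P i k * Q k j" for k
    unfolding T_def S_def by (metis mult.assoc mult.left_commute mult_1_right)
  then show "(\<Sum>k<n. T i k * S k j) = (if i = j then 1 else 0)"
    using PQ[OF \<open>i < n\<close> \<open>j < n\<close>] by simp
next
  fix i w assume "i < n"
  have "(\<Sum>j<n. S i j * A j l) = (\<Sum>k<n. B i k * of_real (\<epsilon> ^ (k - i)) * S k l)" if "l < n" for l
    using rescaled_similarity[where n = n and B = B and Q = Q and A = A and i = i and j = l,
        OF \<open>\<epsilon> > 0\<close> upper QA[OF \<open>i < n\<close> that] \<open>i < n\<close>]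
    by (simp add: S_def mult.assoc)
  then show "(\<Sum>j<n. S i j * (\<Sum>l<n. A j l * w l))
      = (\<Sum>k<n. B i k * of_real (\<epsilon> ^ (k - i)) * (\<Sum>l<n. S k l * w l))"
    unfolding sum_matrix_vector_assoc[of S] sum_matrix_vector_assoc[of "\<lambda>i k. B i k * of_real (\<epsilon> ^ (k - i))"]
    by simp
qed

lemma finite_uniform_negative_bound:
  fixes f :: "nat \<Rightarrow> real"
  assumes "\<And>i. i < n \<Longrightarrow> f i < 0"
  shows "\<exists>sg>0. \<forall>i<n. f i \<le> - sg"
proof (intro exI conjI allI impI)
  show "Min (insert 1 ((\<lambda>i. - f i) ` {..<n})) > 0"
    using assms by (auto simp: Min_gr_iff)
  show "f i \<le> - Min (insert 1 ((\<lambda>i. - f i) ` {..<n}))" if "i < n" for i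
  proof -
    have "Min (insert 1 ((\<lambda>i. - f i) ` {..<n})) \<le> - f i"
      using that by (intro Min_le) auto
    then show ?thesis
      by linarith
  qed
qed

lemma stable_nat_matrix_lyapunov:
  fixes A :: "nat \<Rightarrow> nat \<Rightarrow> complex"
  assumes eig: "\<And>\<mu> v. (\<exists>j<n. v j \<noteq> 0) \<Longrightarrow> (\<forall>k<n. (\<Sum>j<n. A k j * v j) = \<mu> * v k) \<Longrightarrow> Re \<mu> < 0"
  shows "\<exists>c sg (S :: nat \<Rightarrow> nat \<Rightarrow> complex). c > 0 \<and> sg > 0 \<and>
    (\<forall>w. c * (\<Sum>j<n. (cmod (w j))\<^sup>2) \<le> (\<Sum>i<n. (cmod (\<Sum>j<n. S i j * w j))\<^sup>2)) \<and>
    (\<forall>w. Re (\<Sum>i<n. cnj (\<Sum>j<n. S i j * w j) * (\<Sum>j<n. S i j * (\<Sum>l<n. A j l * w l)))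
      \<le> - sg * (\<Sum>i<n. (cmod (\<Sum>j<n. S i j * w j))\<^sup>2))"
proof -
  obtain B P Q :: "nat \<Rightarrow> nat \<Rightarrow> complex" where upper: "\<And>i j. i < n \<Longrightarrow> j < i \<Longrightarrow> B i j = 0"
    and PQ: "\<And>i j. i < n \<Longrightarrow> j < n \<Longrightarrow> (\<Sum>k<n. P i k * Q k j) = (if i = j then 1 else 0)"
    and QA: "\<And>i j. i < n \<Longrightarrow> j < n \<Longrightarrow> (\<Sum>k<n. Q i k * A k j) = (\<Sum>k<n. B i k * Q k j)"
    and eigen: "\<And>i. i < n \<Longrightarrow> \<exists>v. (\<exists>j<n. v j \<noteq> 0) \<and> (\<forall>k<n. (\<Sum>j<n. A k j * v j) = B i i * v k)"
    using schur_triangularization_nat[of n A] by blast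
  have "Re (B i i) < 0" if "i < n" for i
    using eigen[OF that] eig by blast
  then have "\<exists>sg>0. \<forall>i<n. Re (B i i) \<le> - sg"
    by (rule finite_uniform_negative_bound)
  then obtain sg where "sg > 0" and diag: "\<And>i. i < n \<Longrightarrow> Re (B i i) \<le> - sg"
    by blast
  obtain \<epsilon> where "\<epsilon> > 0" and dissipative: "\<And>w.
      Re (\<Sum>i<n. cnj (w i) * (\<Sum>j<n. B i j * of_real (\<epsilon> ^ (j - i)) * w j))
        \<le> - (sg / 2) * (\<Sum>i<n. (cmod (w i))\<^sup>2)"
    using upper_triangular_rescaled_dissipative[where n = n and B = B, OF upper diag \<open>sg > 0\<close>] by blast
  define S where "S = (\<lambda>i j. of_real ((1 / \<epsilon>) ^ i) * Q i j :: complex)"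
  define T where "T = (\<lambda>i j. P i j * of_real (\<epsilon> ^ j) :: complex)"
  have "(\<Sum>k<n. T i k * S k j) = (if i = j then 1 else 0)" if "i < n" "j < n" for i j
    using diagonal_rescaling(1)[OF \<open>\<epsilon> > 0\<close> upper PQ QA that] by (simp add: S_def T_def)
  then obtain c where "c > 0"
    "\<And>w. c * (\<Sum>j<n. (cmod (w j))\<^sup>2) \<le> (\<Sum>i<n. (cmod (\<Sum>j<n. S i j * w j))\<^sup>2)"
    using left_inverse_lower_bound by blast
  moreover have "Re (\<Sum>i<n. cnj (\<Sum>j<n. S i j * w j) * (\<Sum>j<n. S i j * (\<Sum>l<n. A j l * w l)))
      \<le> - (sg / 2) * (\<Sum>i<n. (cmod (\<Sum>j<n. S i j * w j))\<^sup>2)" for w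
    using dissipative[of "\<lambda>i. \<Sum>j<n. S i j * w j"] diagonal_rescaling(2)[OF \<open>\<epsilon> > 0\<close> upper PQ QA]
    unfolding S_def by simp
  ultimately show ?thesis
    using \<open>sg > 0\<close> by (intro exI[of _ c] exI[of _ "sg / 2"] exI[of _ S]) simp
qed

definition hurwitz :: "real^'n^'n \<Rightarrow> bool" where
  "hurwitz M \<longleftrightarrow> (\<forall>(\<mu>::complex) (v::complex^'n). v \<noteq> 0 \<and> cmat M *v v = \<mu> *s v \<longrightarrow> Re \<mu> < 0)"

lemma stabilisable_iff_hurwitz: "stabilisable A B \<longleftrightarrow> (\<exists>K. hurwitz (A + B ** K))"
  by (simp add: stabilisable_def hurwitz_def)

lemma hurwitz_eigenvalue_enumerated:
  fixes M :: "real^'n^'n" and fr :: "nat \<Rightarrow> 'n"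
  assumes "hurwitz M" and fr: "bij_betw fr {..<CARD('n)} UNIV"
    and "\<exists>j<CARD('n). v j \<noteq> 0"
    and eigen: "\<forall>k<CARD('n). (\<Sum>j<CARD('n). of_real (M $ fr k $ fr j) * v j) = \<mu> * v k"
  shows "Re \<mu> < 0"
proof -
  define to where "to = inv_into {..<CARD('n)} fr"
  have to_fr: "to (fr j) = j" if "j < CARD('n)" for j
    using fr that by (simp add: to_def bij_betw_inv_into_left)
  have fr_to: "fr (to k) = k" "to k < CARD('n)" for k
    using fr bij_betw_inv_into_right[OF fr] bij_betwE[OF bij_betw_inv_into[OF fr]]
    by (auto simp: to_def)
  define vt :: "complex^'n" where "vt = (\<chi> k. v (to k))"
  obtain j where "j < CARD('n)" "v j \<noteq> 0"
    using assms(3) by blast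
  then have "vt $ fr j \<noteq> 0"
    by (simp add: vt_def to_fr)
  then have "vt \<noteq> 0"
    by auto
  moreover have "cmat M *v vt = \<mu> *s vt"
  proof -
    have "(cmat M *v vt) $ k = (\<Sum>j<CARD('n). of_real (M $ fr (to k) $ fr j) * v j)" for k
      unfolding matrix_vector_mult_def cmat_def vt_def
      using sum.reindex_bij_betw[OF fr, of "\<lambda>l. of_real (M $ k $ l) * v (to l)"]
      by (simp add: to_fr fr_to)
    also have "\<dots> k = (\<mu> *s vt) $ k" for k
      using eigen[rule_format, of "to k"] fr_to by (simp add: vt_def)
    finally show ?thesis
      by (simp add: Finite_Cartesian_Product.vec_eq_iff)
  qed
  ultimately show ?thesis
    using \<open>hurwitz M\<close> unfolding hurwitz_def by blast
qed

lemma sum_times_UNIV_bool: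
  "(\<Sum>p\<in>A \<times> (UNIV :: bool set). f p) = (\<Sum>i\<in>A. f (i, True) + f (i, False))"
proof -
  have "(\<Sum>p\<in>A \<times> UNIV. f p) = (\<Sum>i\<in>A. \<Sum>b\<in>UNIV. f (i, b))"
    by (rule sum.cartesian_product')
  then show ?thesis
    by (simp add: UNIV_bool add.commute)
qed

lemma hurwitz_sum_squares_lyapunov:
  fixes M :: "real^'n^'n"
  assumes "hurwitz M"
  shows "\<exists>(L :: nat \<times> bool \<Rightarrow> real^'n) c sg. c > 0 \<and> sg > 0 \<and>
    (\<forall>e. c * (norm e)\<^sup>2 \<le> (\<Sum>p\<in>{..<CARD('n)} \<times> UNIV. (L p \<bullet> e)\<^sup>2)) \<and>
    (\<forall>e. (\<Sum>p\<in>{..<CARD('n)} \<times> UNIV. (L p \<bullet> e) * (L p \<bullet> (M *v e)))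
      \<le> - sg * (\<Sum>p\<in>{..<CARD('n)} \<times> UNIV. (L p \<bullet> e)\<^sup>2))"
proof -
  define n where "n = CARD('n)"
  \<comment> \<open>the Schur decomposition of Jordan_Normal_Form works with nat-indexed matrices\<close>
  obtain fr :: "nat \<Rightarrow> 'n" where fr: "bij_betw fr {..<n} UNIV"
    using ex_bij_betw_nat_finite[of "UNIV :: 'n set"] by (auto simp: n_def atLeast0LessThan)
  define to where "to = inv_into {..<n} fr"
  have to_fr: "to (fr j) = j" if "j < n" for j
    using fr that by (simp add: to_def bij_betw_inv_into_left)
  have reindex: "(\<Sum>k\<in>UNIV. g k) = (\<Sum>j<n. g (fr j))" for g :: "'n \<Rightarrow> 'a::comm_monoid_add"
    by (rule sum.reindex_bij_betw[OF fr, symmetric])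
  define A where "A k j = complex_of_real (M $ fr k $ fr j)" for k j
  have eig: "Re \<mu> < 0" if "\<exists>j<n. v j \<noteq> 0" "\<forall>k<n. (\<Sum>j<n. A k j * v j) = \<mu> * v k" for \<mu> v
    using hurwitz_eigenvalue_enumerated[OF \<open>hurwitz M\<close> fr[unfolded n_def]]
      that[unfolded n_def A_def] by blast
  have "\<exists>c sg (S :: nat \<Rightarrow> nat \<Rightarrow> complex). c > 0 \<and> sg > 0 \<and>
    (\<forall>w. c * (\<Sum>j<n. (cmod (w j))\<^sup>2) \<le> (\<Sum>i<n. (cmod (\<Sum>j<n. S i j * w j))\<^sup>2)) \<and>
    (\<forall>w. Re (\<Sum>i<n. cnj (\<Sum>j<n. S i j * w j) * (\<Sum>j<n. S i j * (\<Sum>l<n. A j l * w l)))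
      \<le> - sg * (\<Sum>i<n. (cmod (\<Sum>j<n. S i j * w j))\<^sup>2))"
    by (rule stable_nat_matrix_lyapunov) (rule eig)
  then obtain c sg :: real and S :: "nat \<Rightarrow> nat \<Rightarrow> complex" where "c > 0" "sg > 0"
    and lower: "\<And>w. c * (\<Sum>j<n. (cmod (w j))\<^sup>2) \<le> (\<Sum>i<n. (cmod (\<Sum>j<n. S i j * w j))\<^sup>2)"
    and dissipative: "\<And>w. Re (\<Sum>i<n. cnj (\<Sum>j<n. S i j * w j) * (\<Sum>j<n. S i j * (\<Sum>l<n. A j l * w l)))
      \<le> - sg * (\<Sum>i<n. (cmod (\<Sum>j<n. S i j * w j))\<^sup>2)"
    by blast
  define w where "w e j = complex_of_real (e $ fr j)" for e :: "real^'n" and j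
  define Sw where "Sw e i = (\<Sum>j<n. S i j * w e j)" for e i
  define L :: "nat \<times> bool \<Rightarrow> real^'n" where
    "L p = (\<chi> k. if snd p then Re (S (fst p) (to k)) else Im (S (fst p) (to k)))" for p
  have L_inner: "L (i, True) \<bullet> e = Re (Sw e i)" "L (i, False) \<bullet> e = Im (Sw e i)" for i e
    unfolding L_def Sw_def w_def inner_vec_def reindex by (simp_all add: to_fr Re_sum Im_sum)
  have norm_eq: "(norm e)\<^sup>2 = (\<Sum>j<n. (cmod (w e j))\<^sup>2)" for e
    unfolding power2_norm_eq_inner[of e] inner_vec_def reindex by (simp add: w_def power2_eq_square)
  have Mw: "w (M *v e) j = (\<Sum>l<n. A j l * w e l)" for e j
    by (simp add: w_def A_def matrix_vector_mult_def reindex)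
  have squares: "(\<Sum>p\<in>{..<n} \<times> UNIV. (L p \<bullet> e)\<^sup>2) = (\<Sum>i<n. (cmod (Sw e i))\<^sup>2)" for e
    unfolding sum_times_UNIV_bool L_inner by (simp add: cmod_power2)
  have "(\<Sum>p\<in>{..<n} \<times> UNIV. (L p \<bullet> e) * (L p \<bullet> (M *v e))) = Re (\<Sum>i<n. cnj (Sw e i) * Sw (M *v e) i)"
    for e
    unfolding sum_times_UNIV_bool L_inner Re_sum by (intro sum.cong refl) simp
  moreover have "Sw (M *v e) i = (\<Sum>j<n. S i j * (\<Sum>l<n. A j l * w e l))" for e i
    unfolding Sw_def Mw ..
  ultimately have dissipative': "(\<Sum>p\<in>{..<n} \<times> UNIV. (L p \<bullet> e) * (L p \<bullet> (M *v e)))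
      \<le> - sg * (\<Sum>p\<in>{..<n} \<times> UNIV. (L p \<bullet> e)\<^sup>2)" for e
    unfolding squares Sw_def using dissipative[of "w e"] by simp
  have lower': "c * (norm e)\<^sup>2 \<le> (\<Sum>p\<in>{..<n} \<times> UNIV. (L p \<bullet> e)\<^sup>2)" for e
    unfolding squares norm_eq using lower[of "w e"] by (simp add: Sw_def)
  show ?thesis
    using \<open>c > 0\<close> \<open>sg > 0\<close> lower' dissipative' unfolding n_def by blast
qed

section \<open>Exponential decay of the flow\<close>

lemma inner_linear_flow_has_real_derivative:
  fixes M :: "real^'n^'n"
  shows "((\<lambda>s. l \<bullet> linear_flow M s v) has_real_derivative l \<bullet> (M *v linear_flow M s v)) (at s)"
proof -
  have "((\<lambda>s. l \<bullet> linear_flow M s v) has_derivative (\<lambda>h. l \<bullet> (h *\<^sub>R (M *v linear_flow M s v)))) (at s)"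
    using linear_flow_has_vector_derivative unfolding has_vector_derivative_def
    by (rule has_derivative_inner_right)
  then show ?thesis
    unfolding has_field_derivative_def by (rule has_derivative_eq_rhs) (simp add: fun_eq_iff)
qed

lemma sum_squares_linear_flow_decay:
  fixes M :: "real^'n^'n" and L :: "'i \<Rightarrow> real^'n"
  assumes "sg \<ge> 0" and "t \<ge> 0"
    and dissipative: "\<And>e. (\<Sum>p\<in>I. (L p \<bullet> e) * (L p \<bullet> (M *v e))) \<le> - sg * (\<Sum>p\<in>I. (L p \<bullet> e)\<^sup>2)"
  shows "(\<Sum>p\<in>I. (L p \<bullet> linear_flow M t v)\<^sup>2) \<le> exp (- (2 * sg * t)) * (\<Sum>p\<in>I. (L p \<bullet> v)\<^sup>2)"
proof -
  define W where "W s = (\<Sum>p\<in>I. (L p \<bullet> linear_flow M s v)\<^sup>2)" for s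
  define D where "D s = 2 * (\<Sum>p\<in>I. (L p \<bullet> linear_flow M s v) * (L p \<bullet> (M *v linear_flow M s v)))" for s
  have W_deriv: "(W has_real_derivative D s) (at s)" for s
    unfolding W_def D_def sum_distrib_left
    by (auto intro!: derivative_eq_intros inner_linear_flow_has_real_derivative
        simp: power2_eq_square mult.assoc)
  have "((\<lambda>s. exp (2 * sg * s) * W s) has_real_derivative exp (2 * sg * s) * (D s + 2 * sg * W s)) (at s)"
    for s
    by (auto intro!: derivative_eq_intros W_deriv simp: algebra_simps)
  moreover have "exp (2 * sg * s) * (D s + 2 * sg * W s) \<le> 0" for s
    using dissipative[of "linear_flow M s v"] by (intro mult_nonneg_nonpos) (auto simp: D_def W_def)
  ultimately have "exp (2 * sg * t) * W t \<le> exp (2 * sg * 0) * W 0"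
    using DERIV_nonpos_imp_nonincreasing[OF \<open>t \<ge> 0\<close>, of "\<lambda>s. exp (2 * sg * s) * W s"] by blast
  then show ?thesis
    by (simp add: W_def exp_minus field_simps)
qed

lemma hurwitz_linear_flow_exponential_decay:
  fixes M :: "real^'n^'n"
  assumes "hurwitz M"
  shows "\<exists>C sg. C > 0 \<and> sg > 0 \<and>
    (\<forall>t v. t \<ge> 0 \<longrightarrow> norm (linear_flow M t v) \<le> C * exp (- sg * t) * norm v)"
proof -
  let ?I = "{..<CARD('n)} \<times> (UNIV :: bool set)"
  obtain L :: "nat \<times> bool \<Rightarrow> real^'n" and c sg :: real where "c > 0" "sg > 0"
    and lower: "\<And>e. c * (norm e)\<^sup>2 \<le> (\<Sum>p\<in>?I. (L p \<bullet> e)\<^sup>2)"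
    and dissipative: "\<And>e. (\<Sum>p\<in>?I. (L p \<bullet> e) * (L p \<bullet> (M *v e))) \<le> - sg * (\<Sum>p\<in>?I. (L p \<bullet> e)\<^sup>2)"
    using hurwitz_sum_squares_lyapunov[OF assms] by blast
  define c' where "c' = (\<Sum>p\<in>?I. (norm (L p))\<^sup>2)"
  have upper: "(\<Sum>p\<in>?I. (L p \<bullet> e)\<^sup>2) \<le> c' * (norm e)\<^sup>2" for e
    unfolding c'_def sum_distrib_right
    by (intro sum_mono) (metis Cauchy_Schwarz_ineq2 abs_ge_zero power_mono power_mult_distrib power2_abs)
  have "c' \<ge> 0"
    unfolding c'_def by (intro sum_nonneg) auto
  define C where "C = sqrt (c' / c) + 1"
  have "norm (linear_flow M t v) \<le> C * exp (- sg * t) * norm v" if "t \<ge> 0" for t v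
  proof -
    have "c * (norm (linear_flow M t v))\<^sup>2 \<le> exp (- (2 * sg * t)) * (\<Sum>p\<in>?I. (L p \<bullet> v)\<^sup>2)"
      using lower sum_squares_linear_flow_decay[OF _ that dissipative] \<open>sg > 0\<close>
      by (meson less_imp_le order_trans)
    also have "\<dots> \<le> exp (- (2 * sg * t)) * (c' * (norm v)\<^sup>2)"
      by (intro mult_left_mono upper) auto
    finally have "(norm (linear_flow M t v))\<^sup>2 \<le> (sqrt (c' / c) * (exp (- sg * t) * norm v))\<^sup>2"
      using \<open>c > 0\<close> \<open>c' \<ge> 0\<close>
      by (simp add: field_simps power_mult_distrib exp_minus power2_eq_square exp_add[symmetric])
    then have "norm (linear_flow M t v) \<le> sqrt (c' / c) * (exp (- sg * t) * norm v)"
      by (rule power2_le_imp_le) (use \<open>c > 0\<close> \<open>c' \<ge> 0\<close> in auto)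
    also have "\<dots> \<le> C * (exp (- sg * t) * norm v)"
      unfolding C_def by (intro mult_right_mono) auto
    finally show ?thesis
      by (simp add: mult.assoc)
  qed
  moreover have "C > 0"
    using \<open>c > 0\<close> \<open>c' \<ge> 0\<close> unfolding C_def by (simp add: add_nonneg_pos)
  ultimately show ?thesis
    using \<open>sg > 0\<close> by blast
qed

lemma hurwitz_linear_flow_bounded_contracting:
  fixes M :: "real^'n^'n"
  assumes "hurwitz M"
  shows "\<exists>C T. C \<ge> 0 \<and> T > 0 \<and> (\<forall>s v. s \<ge> 0 \<longrightarrow> norm (linear_flow M s v) \<le> C * norm v) \<and>
    (\<forall>v. norm (linear_flow M T v) \<le> norm v / 2)"
proof -
  obtain C sg where "C > 0" "sg > 0"
    and decay: "\<And>t v. t \<ge> 0 \<Longrightarrow> norm (linear_flow M t v) \<le> C * exp (- sg * t) * norm v"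
    using hurwitz_linear_flow_exponential_decay[OF assms] by blast
  have bounded: "norm (linear_flow M s v) \<le> C * norm v" if "s \<ge> 0" for s v
  proof -
    have "C * exp (- sg * s) * norm v \<le> C * 1 * norm v"
      using that \<open>C > 0\<close> \<open>sg > 0\<close> by (intro mult_right_mono mult_left_mono) auto
    then show ?thesis
      using decay[OF that, of v] by simp
  qed
  define T where "T = max 1 (ln (2 * C) / sg)"
  have "T > 0"
    by (simp add: T_def)
  have "ln (2 * C) / sg \<le> T"
    by (simp add: T_def)
  then have "ln (2 * C) \<le> sg * T"
    using \<open>sg > 0\<close> by (simp add: pos_divide_le_eq mult.commute)
  then have "C * exp (- sg * T) \<le> C * exp (- ln (2 * C))"
    using \<open>C > 0\<close> by simp
  also have "\<dots> = 1 / 2"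
    using \<open>C > 0\<close> by (simp add: exp_minus)
  finally have contraction: "C * exp (- sg * T) \<le> 1 / 2" .
  have "norm (linear_flow M T v) \<le> norm v / 2" for v
  proof -
    have "norm (linear_flow M T v) \<le> C * exp (- sg * T) * norm v"
      using decay \<open>T > 0\<close> by simp
    also have "\<dots> \<le> 1 / 2 * norm v"
      using contraction by (rule mult_right_mono) simp
    finally show ?thesis
      by simp
  qed
  then show ?thesis
    using \<open>C > 0\<close> \<open>T > 0\<close> bounded by (intro exI[of _ C] exI[of _ T]) simp
qed

section \<open>Periodically rescaled admissible controls\<close>

definition period :: "real \<Rightarrow> real \<Rightarrow> nat" where
  "period T t = nat \<lfloor>t / T\<rfloor>"

lemma period_bounds:
  assumes "T > 0" "t \<ge> 0"
  shows "real (period T t) * T \<le> t" "t < (real (period T t) + 1) * T"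
proof -
  have period: "real (period T t) = of_int \<lfloor>t / T\<rfloor>"
    using assms by (simp add: period_def)
  have "of_int \<lfloor>t / T\<rfloor> * T \<le> t / T * T"
    using assms by (intro mult_right_mono) auto
  then show "real (period T t) * T \<le> t"
    using assms by (simp add: period)
  have "t / T * T < (of_int \<lfloor>t / T\<rfloor> + 1) * T"
    using assms by (intro mult_strict_right_mono) auto
  then show "t < (real (period T t) + 1) * T"
    using assms by (simp add: period)
qed

lemma period_eq:
  assumes "T > 0" "0 \<le> s" "s < T"
  shows "period T (real k * T + s) = k"
proof -
  have "\<lfloor>real k + s / T\<rfloor> = int k"
    using assms by (intro floor_unique) (auto simp: field_simps)
  moreover have "(real k * T + s) / T = real k + s / T"
    using assms by (simp add: field_simps)
  ultimately show ?thesis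
    by (simp add: period_def)
qed

lemma is_traj_at_0:
  assumes "is_traj A B y u x"
  shows "x 0 = y"
proof -
  have "((\<lambda>s. A *v x s + B *v u s) has_integral (x 0 - y)) {0}"
    using assms[unfolded is_traj_def, rule_format, of 0] by simp
  from has_integral_unique[OF this has_integral_refl(2)] show ?thesis
    by simp
qed

lemma is_traj_has_integral:
  assumes "is_traj A B y u x" "0 \<le> c" "c \<le> d"
  shows "((\<lambda>s. A *v x s + B *v u s) has_integral (x d - x c)) {c..d}"
proof -
  let ?f = "\<lambda>s. A *v x s + B *v u s"
  have to_d: "(?f has_integral (x d - y)) {0..d}" and to_c: "(?f has_integral (x c - y)) {0..c}"
    using assms by (auto simp: is_traj_def)
  have "?f integrable_on {c..d}"
    using integrable_subinterval_real[OF has_integral_integrable[OF to_d]] assms(2) by simp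
  then have between: "(?f has_integral integral {c..d} ?f) {c..d}"
    by (rule integrable_integral)
  have "(?f has_integral (x c - y + integral {c..d} ?f)) {0..d}"
    by (rule has_integral_combine[OF assms(2,3) to_c between])
  from has_integral_unique[OF this to_d] have "integral {c..d} ?f = x d - x c"
    by (simp add: algebra_simps)
  then show ?thesis
    using between by simp
qed

locale periodic_rescaling =
  fixes A :: "real^'n^'n" and B :: "real^'m^'n" and K :: "real^'n^'m"
    and E :: "((real^'n) \<times> (real^'m)) set" and U :: "(real^'m) set"
    and C T lam rho RE r :: real
  assumes flow_bounded: "\<And>s v. s \<ge> 0 \<Longrightarrow> norm (linear_flow (A + B ** K) s v) \<le> C * norm v"
    and flow_contracts: "\<And>v. norm (linear_flow (A + B ** K) T v) \<le> norm v / 2"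
    and C_nonneg: "C \<ge> 0" and T_pos: "T > 0"
    and lam: "0 \<le> lam" "lam < 1" and rho: "3 / 4 \<le> rho" "rho < 1"
    and E_bounded: "\<And>x u. (x, u) \<in> E \<Longrightarrow> norm x \<le> RE \<and> norm u \<le> RE"
    and r_pos: "r > 0"
    and E_ball: "\<And>x u. norm x + norm u < r \<Longrightarrow> (x, u) \<in> E"
    and U_ball: "\<And>u. norm u < r \<Longrightarrow> u \<in> U"
    (* keeps z / (1 - a\<^sub>k) and K z / (1 - a\<^sub>k) inside the balls of radius r *)
    and small: "4 * C * (1 - rho) * RE * (1 + onorm ((*v) K)) \<le> (1 - lam) * r / 2"
    and E_convex: "convex E" and U_convex: "convex U"
begin

abbreviation "closed_loop \<equiv> A + B ** K"

definition "weight k = lam * rho ^ k"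

definition "jump_bound = 4 * lam * (1 - rho) * RE"

definition "decay_bound = lam * RE + C * jump_bound * (1 + onorm ((*v) K))"

lemma RE_nonneg: "RE \<ge> 0"
  using E_bounded[of 0 0] E_ball[of 0 0] r_pos by simp

lemma weight_nonneg: "0 \<le> weight k"
  using lam rho by (simp add: weight_def)

lemma weight_le: "weight k \<le> lam"
  using lam rho by (simp add: weight_def mult_left_le power_le_one)

lemma weight_diff: "weight k - weight (Suc k) = lam * rho ^ k * (1 - rho)"
  by (simp add: weight_def algebra_simps)

lemma jump_bound_nonneg: "jump_bound \<ge> 0"
  using lam rho RE_nonneg by (simp add: jump_bound_def)

lemma norm_K_le: "norm (K *v w) \<le> onorm ((*v) K) * norm w"
  by (rule onorm) (rule matrix_vector_mul_bounded_linear)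

context
  fixes y :: "real^'n" and uy :: "real \<Rightarrow> real^'m" and xy :: "real \<Rightarrow> real^'n"
  assumes uy_Linf: "Linf_loc uy" and y_traj: "is_traj A B y uy xy"
    and y_admissible: "\<And>t. t \<ge> 0 \<Longrightarrow> (xy t, uy t) \<in> E \<and> uy t \<in> U"
begin

(* In the notation of the proof idea, weight k is a\<^sub>k, offset is z and corrector k is z (k T). *)
primrec corrector :: "nat \<Rightarrow> real^'n" where
  "corrector 0 = 0"
| "corrector (Suc k) = linear_flow closed_loop T (corrector k)
    + (weight k - weight (Suc k)) *\<^sub>R xy (real (Suc k) * T)"

definition "offset t = linear_flow closed_loop (t - real (period T t) * T) (corrector (period T t))"

definition "state t = weight (period T t) *\<^sub>R xy t + offset t"

definition "input t = weight (period T t) *\<^sub>R uy t + K *v offset t"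

(* One period of the flow halves the bound and the weight drop adds a quarter of it. *)
lemma norm_corrector_le: "norm (corrector k) \<le> jump_bound * rho ^ k"
proof (induction k)
  case 0
  then show ?case
    using jump_bound_nonneg by simp
next
  case (Suc k)
  have "(xy (real (Suc k) * T), uy (real (Suc k) * T)) \<in> E"
    using y_admissible T_pos by simp
  then have "norm (xy (real (Suc k) * T)) \<le> RE"
    using E_bounded by blast
  then have "norm ((weight k - weight (Suc k)) *\<^sub>R xy (real (Suc k) * T)) \<le> lam * rho ^ k * (1 - rho) * RE"
    using lam rho by (simp add: weight_diff mult_left_mono)
  moreover have "norm (linear_flow closed_loop T (corrector k)) \<le> jump_bound * rho ^ k / 2"
    using flow_contracts[of "corrector k"] Suc.IH by simp
  ultimately have "norm (corrector (Suc k)) \<le> jump_bound * rho ^ k / 2 + lam * rho ^ k * (1 - rho) * RE"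
    by (simp add: norm_triangle_le add_mono)
  also have "\<dots> = 3 / 4 * (jump_bound * rho ^ k)"
    by (simp add: jump_bound_def field_simps)
  also have "\<dots> \<le> rho * (jump_bound * rho ^ k)"
    using rho jump_bound_nonneg by (intro mult_right_mono) auto
  finally show ?case
    by (simp add: mult_ac)
qed

lemma norm_offset_le:
  assumes "t \<ge> 0"
  shows "norm (offset t) \<le> C * jump_bound * rho ^ period T t"
proof -
  have "t - real (period T t) * T \<ge> 0"
    using period_bounds[OF T_pos assms] by simp
  then have "norm (offset t) \<le> C * norm (corrector (period T t))"
    unfolding offset_def by (rule flow_bounded)
  also have "\<dots> \<le> C * (jump_bound * rho ^ period T t)"
    using norm_corrector_le C_nonneg by (rule mult_left_mono)
  finally show ?thesis
    by (simp add: mult.assoc)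
qed

lemma norm_offset_le_const:
  assumes "t \<ge> 0"
  shows "norm (offset t) \<le> C * jump_bound"
proof -
  have "rho ^ period T t \<le> 1"
    using rho by (intro power_le_one) auto
  then have "C * jump_bound * rho ^ period T t \<le> C * jump_bound"
    using C_nonneg jump_bound_nonneg by (intro mult_left_le) auto
  with norm_offset_le[OF assms] show ?thesis
    by linarith
qed

lemma state_input_admissible:
  assumes "t \<ge> 0"
  shows "(state t, input t) \<in> E \<and> input t \<in> U"
proof -
  define a where "a = weight (period T t)"
  have a: "0 \<le> a" "a \<le> lam"
    unfolding a_def by (rule weight_nonneg, rule weight_le)
  have "norm (K *v offset t) \<le> onorm ((*v) K) * (C * jump_bound)"
    using norm_K_le norm_offset_le_const[OF assms] onorm_pos_le[OF matrix_vector_mul_bounded_linear]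
    by (rule order_trans[OF _ mult_left_mono])
  with norm_offset_le_const[OF assms]
  have "norm (offset t) + norm (K *v offset t) \<le> lam * (4 * C * (1 - rho) * RE * (1 + onorm ((*v) K)))"
    by (simp add: jump_bound_def algebra_simps)
  also have "\<dots> \<le> 1 * ((1 - lam) * r / 2)"
    using small lam C_nonneg rho RE_nonneg onorm_pos_le[OF matrix_vector_mul_bounded_linear, of K]
    by (intro mult_mono) auto
  also have "\<dots> < (1 - a) * r"
  proof -
    have "(1 - a) * r = (1 - lam) * r + (lam - a) * r"
      by (simp add: algebra_simps)
    moreover have "(lam - a) * r \<ge> 0" "(1 - lam) * r > 0"
      using a lam r_pos by simp_all
    ultimately show ?thesis
      by linarith
  qed
  finally have small_offset: "norm ((1 / (1 - a)) *\<^sub>R offset t) + norm ((1 / (1 - a)) *\<^sub>R (K *v offset t)) < r"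
    using a lam by (simp add: add_divide_distrib[symmetric] divide_less_eq mult.commute)
  define q where "q = (1 / (1 - a)) *\<^sub>R (offset t, K *v offset t)"
  have "norm ((1 / (1 - a)) *\<^sub>R (K *v offset t)) < r"
    using small_offset norm_ge_zero[of "(1 / (1 - a)) *\<^sub>R offset t"] by linarith
  then have "q \<in> E" "snd q \<in> U"
    using E_ball[OF small_offset] U_ball by (simp_all add: q_def)
  moreover have "(xy t, uy t) \<in> E" "uy t \<in> U"
    using y_admissible[OF assms] by auto
  ultimately have "a *\<^sub>R (xy t, uy t) + (1 - a) *\<^sub>R q \<in> E" "a *\<^sub>R uy t + (1 - a) *\<^sub>R snd q \<in> U"
    using a lam by (intro convexD[OF E_convex] convexD[OF U_convex]; simp)+
  moreover have "a *\<^sub>R (xy t, uy t) + (1 - a) *\<^sub>R q = (state t, input t)"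
    "a *\<^sub>R uy t + (1 - a) *\<^sub>R snd q = input t"
    using a lam by (simp_all add: q_def state_def input_def a_def)
  ultimately show ?thesis
    by simp
qed

lemma state_input_decay:
  assumes "t \<ge> 0"
  shows "norm (state t) \<le> rho ^ period T t * decay_bound"
    and "norm (input t) \<le> rho ^ period T t * decay_bound"
proof -
  define k where "k = period T t"
  have "norm (xy t) \<le> RE" "norm (uy t) \<le> RE"
    using E_bounded y_admissible[OF assms] by auto
  moreover have "norm (weight k *\<^sub>R z) \<le> rho ^ k * (lam * RE)" if "norm z \<le> RE" for z
  proof -
    have "norm (weight k *\<^sub>R z) \<le> weight k * RE"
      using that weight_nonneg[of k] by (simp add: mult_left_mono)
    then show ?thesis
      by (simp add: weight_def mult_ac)
  qed
  ultimately have xy: "norm (weight k *\<^sub>R xy t) \<le> rho ^ k * (lam * RE)"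
    and uy: "norm (weight k *\<^sub>R uy t) \<le> rho ^ k * (lam * RE)"
    by blast+
  have offset: "norm (offset t) \<le> rho ^ k * (C * jump_bound)"
    using norm_offset_le[OF assms] by (simp add: k_def mult_ac)
  have "norm (K *v offset t) \<le> onorm ((*v) K) * (rho ^ k * (C * jump_bound))"
    using norm_K_le offset onorm_pos_le[OF matrix_vector_mul_bounded_linear]
    by (rule order_trans[OF _ mult_left_mono])
  moreover have "0 \<le> onorm ((*v) K) * (rho ^ k * (C * jump_bound))"
    using onorm_pos_le[OF matrix_vector_mul_bounded_linear, of K] C_nonneg jump_bound_nonneg rho
    by simp
  moreover have "rho ^ k * decay_bound
      = rho ^ k * (lam * RE) + rho ^ k * (C * jump_bound) + onorm ((*v) K) * (rho ^ k * (C * jump_bound))"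
    by (simp add: decay_bound_def algebra_simps)
  ultimately show "norm (state t) \<le> rho ^ period T t * decay_bound"
    "norm (input t) \<le> rho ^ period T t * decay_bound"
    unfolding state_def input_def k_def[symmetric] using xy uy offset norm_ge_zero[of "offset t"]
    by (intro norm_triangle_le; linarith)+
qed

lemma state_input_equation:
  assumes "period T \<tau> = k"
  shows "A *v state \<tau> + B *v input \<tau> = weight k *\<^sub>R (A *v xy \<tau> + B *v uy \<tau>)
    + closed_loop *v linear_flow closed_loop (\<tau> - real k * T) (corrector k)"
  unfolding state_def input_def offset_def assms
  by (simp add: matrix_vector_right_distrib matrix_vector_mult_scaleR matrix_vector_mul_assoc
      matrix_vector_mult_add_rdistrib scaleR_right_distrib)

lemma state_input_has_integral_period:
  assumes "0 \<le> s" "s \<le> T"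
  shows "((\<lambda>\<tau>. A *v state \<tau> + B *v input \<tau>) has_integral
      weight k *\<^sub>R (xy (real k * T + s) - xy (real k * T))
      + (linear_flow closed_loop s (corrector k) - corrector k)) {real k * T..real k * T + s}"
proof -
  define c where "c = real k * T"
  have "c \<ge> 0"
    using T_pos by (simp add: c_def)
  have "((\<lambda>\<tau>. weight k *\<^sub>R (A *v xy \<tau> + B *v uy \<tau>)
      + closed_loop *v linear_flow closed_loop (\<tau> - c) (corrector k)) has_integral
      weight k *\<^sub>R (xy (c + s) - xy c) + (linear_flow closed_loop (c + s - c) (corrector k) - corrector k))
      {c..c + s}"
    using \<open>c \<ge> 0\<close> assms
    by (intro has_integral_add has_integral_cmul is_traj_has_integral[OF y_traj] linear_flow_has_integral)
      auto
  then have g: "((\<lambda>\<tau>. weight k *\<^sub>R (A *v xy \<tau> + B *v uy \<tau>)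
      + closed_loop *v linear_flow closed_loop (\<tau> - c) (corrector k)) has_integral
      weight k *\<^sub>R (xy (c + s) - xy c) + (linear_flow closed_loop s (corrector k) - corrector k))
      {c..c + s}"
    by simp
  have "((\<lambda>\<tau>. A *v state \<tau> + B *v input \<tau>) has_integral
      weight k *\<^sub>R (xy (c + s) - xy c) + (linear_flow closed_loop s (corrector k) - corrector k))
      {c..c + s}"
  proof (rule has_integral_spike_finite[OF _ _ g])
    fix \<tau> assume "\<tau> \<in> {c..c + s} - {c + T}"
    then have "period T (real k * T + (\<tau> - c)) = k"
      using assms by (intro period_eq T_pos) (auto simp: c_def)
    then show "A *v state \<tau> + B *v input \<tau> = weight k *\<^sub>R (A *v xy \<tau> + B *v uy \<tau>)
        + closed_loop *v linear_flow closed_loop (\<tau> - c) (corrector k)"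
      using state_input_equation[of \<tau> k] by (simp add: c_def)
  qed simp
  then show ?thesis
    by (simp add: c_def)
qed

lemma state_input_has_integral_upto:
  assumes "0 \<le> s" "s \<le> T"
  shows "((\<lambda>\<tau>. A *v state \<tau> + B *v input \<tau>) has_integral
      weight k *\<^sub>R xy (real k * T + s) + linear_flow closed_loop s (corrector k) - lam *\<^sub>R y)
      {0..real k * T + s}"
  using assms
proof (induction k arbitrary: s)
  case 0
  then show ?case
    using state_input_has_integral_period[OF 0, of 0] is_traj_at_0[OF y_traj]
    by (simp add: weight_def algebra_simps)
next
  case (Suc k)
  define c where "c = real (Suc k) * T"
  have "c \<ge> 0" "c = real k * T + T"
    using T_pos by (simp_all add: c_def algebra_simps)
  have "((\<lambda>\<tau>. A *v state \<tau> + B *v input \<tau>) has_integral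
      (weight k *\<^sub>R xy c + linear_flow closed_loop T (corrector k) - lam *\<^sub>R y)
      + (weight (Suc k) *\<^sub>R (xy (c + s) - xy c) + (linear_flow closed_loop s (corrector (Suc k)) - corrector (Suc k))))
      {0..c + s}"
    using Suc.IH[of T] T_pos state_input_has_integral_period[OF Suc.prems, of "Suc k"] \<open>c \<ge> 0\<close> Suc.prems
    unfolding \<open>c = real k * T + T\<close>[symmetric]
    by (intro has_integral_combine[of 0 c "c + s"]) (auto simp: c_def)
  then show ?case
    by (simp add: c_def algebra_simps)
qed

lemma is_traj_state: "is_traj A B (lam *\<^sub>R y) input state"
  unfolding is_traj_def
proof (intro allI impI)
  fix t :: real
  assume "t \<ge> 0"
  define k where "k = period T t"
  define s where "s = t - real k * T"
  have "0 \<le> s" "s \<le> T" "real k * T + s = t"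
    using period_bounds[OF T_pos \<open>t \<ge> 0\<close>] by (auto simp: s_def k_def algebra_simps)
  with state_input_has_integral_upto[of s k] show "((\<lambda>s. A *v state s + B *v input s) has_integral state t - lam *\<^sub>R y) {0..t}"
    by (simp add: state_def offset_def s_def k_def)
qed

lemma input_measurable: "input \<in> borel_measurable (restrict_space lborel {0..})"
proof (rule measurable_piecewise_restrict2[where A = "\<lambda>k. {real k * T..<(real k + 1) * T}"])
  fix k :: nat
  have "0 \<le> real k * T"
    using T_pos by simp
  then show "{real k * T..<(real k + 1) * T} \<in> sets (restrict_space lborel {0..})"
    by (subst sets_restrict_space_iff) auto
next
  have "t \<in> (\<Union>k. {real k * T..<(real k + 1) * T})" if "t \<ge> 0" for t
    using period_bounds[OF T_pos that] by (intro UN_I[of "period T t"]) auto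
  moreover have "0 \<le> t" if "t \<in> {real k * T..<(real k + 1) * T}" for t k
    using that T_pos by (meson atLeastLessThan_iff mult_nonneg_nonneg of_nat_0_le_iff order_trans less_imp_le)
  ultimately show "space (restrict_space lborel {0..}) = (\<Union>k. {real k * T..<(real k + 1) * T})"
    by (auto simp: space_restrict_space)
next
  fix k :: nat
  define h where "h t = weight k *\<^sub>R uy t + K *v linear_flow closed_loop (t - real k * T) (corrector k)" for t
  have "continuous_on UNIV (\<lambda>t. K *v linear_flow closed_loop (t - real k * T) (corrector k))"
    by (intro linear_continuous_on_compose[OF _ matrix_vector_mul_linear] continuous_on_compose2[OF
          continuous_on_linear_flow] continuous_intros) auto
  then have "(\<lambda>t. K *v linear_flow closed_loop (t - real k * T) (corrector k)) \<in> borel_measurable borel"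
    by (rule borel_measurable_continuous_onI)
  then have "(\<lambda>t. K *v linear_flow closed_loop (t - real k * T) (corrector k))
      \<in> borel_measurable (restrict_space lborel {0..})"
    by (intro measurable_restrict_space1) simp
  then have "h \<in> borel_measurable (restrict_space lborel {0..})"
    using uy_Linf unfolding h_def Linf_loc_def by (intro borel_measurable_add borel_measurable_scaleR) auto
  moreover have "input t = h t" if "t \<in> {real k * T..<(real k + 1) * T}" for t
  proof -
    have "period T (real k * T + (t - real k * T)) = k"
      using that by (intro period_eq T_pos) (auto simp: algebra_simps)
    then show ?thesis
      by (simp add: input_def offset_def h_def)
  qed
  ultimately show "\<exists>h \<in> borel_measurable (restrict_space lborel {0..}).
      \<forall>t \<in> {real k * T..<(real k + 1) * T}. input t = h t"
    by blast
qed

lemma input_admissible: "input \<in> adm_controls A B E U (lam *\<^sub>R y)"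
proof -
  have "norm (input t) \<le> RE" if "t \<ge> 0" for t
    using state_input_admissible[OF that] E_bounded by blast
  then have "Linf_loc input"
    unfolding Linf_loc_def using input_measurable by (auto intro!: exI[of _ RE] AE_I2)
  then show ?thesis
    unfolding adm_controls_def using is_traj_state state_input_admissible by blast
qed

end

lemma viab_kernel_rescaled_decaying_control:
  assumes "y \<in> viab_kernel A B E U"
  shows "\<exists>u x. u \<in> adm_controls A B E U (lam *\<^sub>R y) \<and> is_traj A B (lam *\<^sub>R y) u x \<and>
    (\<forall>t\<ge>0. norm (x t) \<le> rho ^ period T t * decay_bound \<and> norm (u t) \<le> rho ^ period T t * decay_bound)"
proof -
  obtain uy xy where "Linf_loc uy" "is_traj A B y uy xy" "\<And>t. t \<ge> 0 \<Longrightarrow> (xy t, uy t) \<in> E \<and> uy t \<in> U"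
    using assms unfolding viab_kernel_def adm_controls_def by blast
  from input_admissible[OF this] is_traj_state[OF this] state_input_decay[OF this] show ?thesis
    by blast
qed

end

section \<open>The cost bound\<close>

lemma nn_integral_periodwise_geometric_le:
  fixes f :: "real \<Rightarrow> real"
  assumes "T > 0" "0 \<le> q" "q < 1" "c \<ge> 0"
    and bound: "\<And>t. t \<ge> 0 \<Longrightarrow> f t \<le> c * q ^ period T t"
  shows "(\<integral>\<^sup>+ t. indicator {0..} t * ennreal (f t) \<partial>lborel) \<le> ennreal (T * c / (1 - q))"
proof -
  define F where "F k t = ennreal (c * q ^ k) * indicator {real k * T..<(real k + 1) * T} t" for k t
  have "indicator {0..} t * ennreal (f t) \<le> (\<Sum>k. F k t)" for t
  proof (cases "t \<ge> 0")
    case True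
    let ?k = "period T t"
    have "t \<in> {real ?k * T..<(real ?k + 1) * T}"
      using period_bounds[OF \<open>T > 0\<close> True] by simp
    then have "indicator {0..} t * ennreal (f t) \<le> F ?k t"
      using True bound[OF True] by (simp add: F_def ennreal_leI)
    also have "\<dots> \<le> (\<Sum>k. F k t)"
      using sum_le_suminf[OF summableI, of "{?k}" "\<lambda>k. F k t"] by simp
    finally show ?thesis .
  qed simp
  then have "(\<integral>\<^sup>+ t. indicator {0..} t * ennreal (f t) \<partial>lborel) \<le> (\<integral>\<^sup>+ t. (\<Sum>k. F k t) \<partial>lborel)"
    by (intro nn_integral_mono)
  also have "\<dots> = (\<Sum>k. \<integral>\<^sup>+ t. F k t \<partial>lborel)"
    by (rule nn_integral_suminf) (simp add: F_def)
  also have "\<dots> = (\<Sum>k. ennreal (T * c * q ^ k))"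
    using \<open>T > 0\<close> \<open>c \<ge> 0\<close> \<open>q \<ge> 0\<close>
    by (simp add: F_def nn_integral_cmult_indicator ennreal_mult'[symmetric] algebra_simps)
  also have "\<dots> = ennreal (\<Sum>k. T * c * q ^ k)"
    using assms by (intro suminf_ennreal2 summable_mult summable_geometric) auto
  also have "(\<Sum>k. T * c * q ^ k) = T * c / (1 - q)"
    using assms by (simp add: suminf_mult suminf_geometric summable_geometric divide_simps)
  finally show ?thesis .
qed

lemma quadratic_cost_le:
  fixes Q :: "real^'n^'n" and S :: "real^'m^'n" and R :: "real^'m^'m"
  assumes "norm x \<le> m" "norm u \<le> m"
  shows "x \<bullet> (Q *v x) + 2 * (x \<bullet> (S *v u)) + u \<bullet> (R *v u)
    \<le> (onorm ((*v) Q) + 2 * onorm ((*v) S) + onorm ((*v) R)) * m\<^sup>2"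
proof -
  have bilinear: "a \<bullet> (N *v b) \<le> onorm ((*v) N) * m\<^sup>2" if "norm a \<le> m" "norm b \<le> m"
    for N :: "real^'b^'a" and a b
  proof -
    have "a \<bullet> (N *v b) \<le> norm a * norm (N *v b)"
      by (rule order_trans[OF abs_ge_self Cauchy_Schwarz_ineq2])
    also have "\<dots> \<le> m * (onorm ((*v) N) * m)"
    proof (rule mult_mono)
      show "norm (N *v b) \<le> onorm ((*v) N) * m"
        using onorm[OF matrix_vector_mul_bounded_linear, of N b]
          mult_left_mono[OF \<open>norm b \<le> m\<close> onorm_pos_le[OF matrix_vector_mul_bounded_linear, of N]]
        by linarith
      show "0 \<le> m"
        using \<open>norm a \<le> m\<close> norm_ge_zero[of a] by linarith
    qed (use that in auto)
    finally show ?thesis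
      by (simp add: power2_eq_square mult_ac)
  qed
  show ?thesis
    using bilinear[of x x Q] bilinear[of x u S] bilinear[of u u R] assms by (simp add: algebra_simps)
qed

lemma compact_interior_bounds:
  fixes E :: "('a::real_normed_vector \<times> 'b::real_normed_vector) set" and U :: "'b set"
  assumes "compact E" "(0, 0) \<in> interior E" "0 \<in> interior U"
  shows "\<exists>RE r. r > 0 \<and> (\<forall>x u. (x, u) \<in> E \<longrightarrow> norm x \<le> RE \<and> norm u \<le> RE) \<and>
    (\<forall>x u. norm x + norm u < r \<longrightarrow> (x, u) \<in> E) \<and> (\<forall>u. norm u < r \<longrightarrow> u \<in> U)"
proof -
  obtain RE where RE: "\<And>p. p \<in> E \<Longrightarrow> norm p \<le> RE"
    using compact_imp_bounded[OF assms(1)] bounded_iff by blast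
  obtain rE rU where "rE > 0" "ball (0, 0) rE \<subseteq> E" "rU > 0" "ball 0 rU \<subseteq> U"
    using assms(2,3) mem_interior by metis
  have "norm x \<le> RE \<and> norm u \<le> RE" if "(x, u) \<in> E" for x u
  proof -
    have "norm x \<le> norm (x, u)" "norm u \<le> norm (x, u)"
      by (rule norm_fst_le, rule norm_snd_le)
    then show ?thesis
      using RE[OF that] by linarith
  qed
  moreover have "(x, u) \<in> E" if "norm x + norm u < min rE rU" for x u
  proof -
    have "norm (x, u) < rE"
      using norm_Pair_le[of x u] that by linarith
    then show ?thesis
      using \<open>ball (0, 0) rE \<subseteq> E\<close> by (auto simp: dist_norm zero_prod_def[symmetric])
  qed
  moreover have "u \<in> U" if "norm u < min rE rU" for u
    using that \<open>ball 0 rU \<subseteq> U\<close> by (auto simp: dist_norm)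
  moreover have "min rE rU > 0"
    using \<open>rE > 0\<close> \<open>rU > 0\<close> by simp
  ultimately show ?thesis
    by blast
qed

lemma ex_rate_small_jumps:
  fixes C RE k lam r :: real
  assumes "C \<ge> 0" "RE \<ge> 0" "k \<ge> 0" "lam < 1" "r > 0"
  shows "\<exists>rho. 3 / 4 \<le> rho \<and> rho < 1 \<and> 4 * C * (1 - rho) * RE * (1 + k) \<le> (1 - lam) * r / 2"
proof -
  define D where "D = (C + 1) * (RE + 1) * (1 + k)"
  have "D > 0" "C * RE * (1 + k) \<le> D"
    using assms unfolding D_def by (auto intro!: mult_mono)
  define \<delta> where "\<delta> = min (1 / 4) ((1 - lam) * r / (8 * D))"
  have "\<delta> > 0"
    using assms \<open>D > 0\<close> by (simp add: \<delta>_def)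
  have "4 * C * \<delta> * RE * (1 + k) = 4 * \<delta> * (C * RE * (1 + k))"
    by (simp add: algebra_simps)
  also have "\<dots> \<le> 4 * \<delta> * D"
    using \<open>\<delta> > 0\<close> \<open>C * RE * (1 + k) \<le> D\<close> by simp
  also have "\<dots> \<le> 4 * ((1 - lam) * r / (8 * D)) * D"
    using \<open>D > 0\<close> by (intro mult_right_mono mult_left_mono) (auto simp: \<delta>_def)
  also have "\<dots> = (1 - lam) * r / 2"
    using \<open>D > 0\<close> by simp
  finally show ?thesis
    using \<open>\<delta> > 0\<close> by (intro exI[of _ "1 - \<delta>"]) (auto simp: \<delta>_def)
qed

lemma stabilisable_rescaled_decaying_controls:
  fixes A :: "real^'n^'n" and B :: "real^'m^'n"
  assumes "stabilisable A B" and "convex E" "compact E" "(0, 0) \<in> interior E"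
    and "convex U" "0 \<in> interior U" and "0 \<le> lam" "lam < 1"
  shows "\<exists>T rho c. T > 0 \<and> 0 \<le> rho \<and> rho < 1 \<and>
    (\<forall>y \<in> viab_kernel A B E U. \<exists>u x. u \<in> adm_controls A B E U (lam *\<^sub>R y) \<and>
      is_traj A B (lam *\<^sub>R y) u x \<and>
      (\<forall>t\<ge>0. norm (x t) \<le> rho ^ period T t * c \<and> norm (u t) \<le> rho ^ period T t * c))"
proof -
  obtain K where "hurwitz (A + B ** K)"
    using assms(1) stabilisable_iff_hurwitz by blast
  then obtain C T where "C \<ge> 0" "T > 0"
    and flow: "\<And>s v. s \<ge> 0 \<Longrightarrow> norm (linear_flow (A + B ** K) s v) \<le> C * norm v"
      "\<And>v. norm (linear_flow (A + B ** K) T v) \<le> norm v / 2"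
    using hurwitz_linear_flow_bounded_contracting by blast
  obtain RE r where "r > 0" and E: "\<And>x u. (x, u) \<in> E \<Longrightarrow> norm x \<le> RE \<and> norm u \<le> RE"
    "\<And>x u. norm x + norm u < r \<Longrightarrow> (x, u) \<in> E" and U: "\<And>u. norm u < r \<Longrightarrow> u \<in> U"
    using compact_interior_bounds[OF assms(3,4,6)] by blast
  have "RE \<ge> 0"
    using E(1)[of 0 0] E(2)[of 0 0] \<open>r > 0\<close> by simp
  obtain rho where rho: "3 / 4 \<le> rho" "rho < 1"
    and small: "4 * C * (1 - rho) * RE * (1 + onorm ((*v) K)) \<le> (1 - lam) * r / 2"
    using ex_rate_small_jumps[OF \<open>C \<ge> 0\<close> \<open>RE \<ge> 0\<close> onorm_pos_le[OF matrix_vector_mul_bounded_linear]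
        assms(8) \<open>r > 0\<close>] by blast
  interpret periodic_rescaling A B K E U C T lam rho RE r
    using flow \<open>C \<ge> 0\<close> \<open>T > 0\<close> assms(2,5,7,8) rho E U \<open>r > 0\<close> small
    by unfold_locales auto
  have "0 \<le> rho"
    using rho by simp
  then show ?thesis
    using \<open>T > 0\<close> \<open>rho < 1\<close> viab_kernel_rescaled_decaying_control by blast
qed

lemma V_inf_quadratic_le:
  fixes Q :: "real^'n^'n" and S :: "real^'m^'n" and R :: "real^'m^'m"
  assumes "u \<in> adm_controls A B E U x0" "is_traj A B x0 u x"
    and "T > 0" "0 \<le> rho" "rho < 1"
    and bound: "\<And>t. t \<ge> 0 \<Longrightarrow> norm (x t) \<le> rho ^ period T t * c \<and> norm (u t) \<le> rho ^ period T t * c"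
  shows "V_inf A B E U (\<lambda>x u. x \<bullet> (Q *v x) + 2 * (x \<bullet> (S *v u)) + u \<bullet> (R *v u)) x0
    \<le> ennreal (T * ((onorm ((*v) Q) + 2 * onorm ((*v) S) + onorm ((*v) R)) * c\<^sup>2) / (1 - rho\<^sup>2))"
    (is "V_inf A B E U ?ell x0 \<le> ennreal (T * (?k * c\<^sup>2) / _)")
proof -
  have "?k \<ge> 0"
    by (intro add_nonneg_nonneg mult_nonneg_nonneg onorm_pos_le matrix_vector_mul_bounded_linear) auto
  have "V_inf A B E U ?ell x0 \<le> (\<integral>\<^sup>+ t. indicator {0..} t * ennreal (?ell (x t) (u t)) \<partial>lborel)"
    unfolding V_inf_def using assms(1,2) by (intro Inf_lower) blast
  also have "\<dots> \<le> ennreal (T * (?k * c\<^sup>2) / (1 - rho\<^sup>2))"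
  proof (rule nn_integral_periodwise_geometric_le)
    fix t :: real
    assume "t \<ge> 0"
    have "(rho ^ period T t * c)\<^sup>2 = (rho\<^sup>2) ^ period T t * c\<^sup>2"
      by (simp add: power2_eq_square power_mult_distrib mult_ac)
    moreover have "?ell (x t) (u t) \<le> ?k * (rho ^ period T t * c)\<^sup>2"
      using bound[OF \<open>t \<ge> 0\<close>] by (intro quadratic_cost_le) auto
    ultimately show "?ell (x t) (u t) \<le> ?k * c\<^sup>2 * (rho\<^sup>2) ^ period T t"
      by (simp add: mult_ac)
  qed (use \<open>T > 0\<close> \<open>0 \<le> rho\<close> \<open>rho < 1\<close> \<open>?k \<ge> 0\<close> in \<open>auto simp: power_less_one_iff abs_square_less_1\<close>)
  finally show ?thesis .
qed

theorem proposition3: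
  fixes A :: "real^'n^'n" and B :: "real^'m^'n"
    and U :: "(real^'m) set" and g :: "(real^'n) \<times> (real^'m) \<Rightarrow> real^'p"
    and Q :: "real^'n^'n" and S :: "real^'m^'n" and R :: "real^'m^'m"
    and E :: "((real^'n) \<times> (real^'m)) set" and ell :: "real^'n \<Rightarrow> real^'m \<Rightarrow> real"
    and lam :: real
  assumes A4: "stabilisable A B"
    and E_def: "E = {(x, u). \<forall>i. g (x, u) $ i \<le> 0}"
    and g_C2: "C2 g"
    and U_convex: "convex U" and U_compact: "compact U" and U_int: "0 \<in> interior U"
    and E_convex: "convex E" and E_compact: "compact E" and E_int: "(0, 0) \<in> interior E"
    and g_convex: "\<forall>x i. convex_on UNIV (\<lambda>u. g (x, u) $ i)"
    and l_def: "ell = (\<lambda>x u. x \<bullet> (Q *v x) + 2 * (x \<bullet> (S *v u)) + u \<bullet> (R *v u))"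
    and Q_sym: "transpose Q = Q" and R_sym: "transpose R = R"
    and pos_def: "\<forall>x u. (x, u) \<noteq> (0, 0) \<longrightarrow> ell x u > 0"
    and lam: "0 \<le> lam" "lam < 1"
  shows "\<exists>M::real. \<forall>x \<in> (\<lambda>y. lam *\<^sub>R y) ` viab_kernel A B E U. V_inf A B E U ell x \<le> ennreal M"
proof -
  \<comment> \<open>The description of \<open>E\<close> by \<open>g\<close>, the compactness of \<open>U\<close> and the symmetry and positivity
    of the cost are not needed for this upper bound.\<close>
  obtain T rho c where "T > 0" "0 \<le> rho" "rho < 1" and decaying: "\<And>y. y \<in> viab_kernel A B E U \<Longrightarrow>
      \<exists>u x. u \<in> adm_controls A B E U (lam *\<^sub>R y) \<and> is_traj A B (lam *\<^sub>R y) u x \<and>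
        (\<forall>t\<ge>0. norm (x t) \<le> rho ^ period T t * c \<and> norm (u t) \<le> rho ^ period T t * c)"
    using stabilisable_rescaled_decaying_controls[OF A4 E_convex E_compact E_int U_convex U_int lam]
    by blast
  have "V_inf A B E U ell (lam *\<^sub>R y)
      \<le> ennreal (T * ((onorm ((*v) Q) + 2 * onorm ((*v) S) + onorm ((*v) R)) * c\<^sup>2) / (1 - rho\<^sup>2))"
    if y: "y \<in> viab_kernel A B E U" for y
  proof -
    obtain u x where "u \<in> adm_controls A B E U (lam *\<^sub>R y)" "is_traj A B (lam *\<^sub>R y) u x"
      "\<And>t. t \<ge> 0 \<Longrightarrow> norm (x t) \<le> rho ^ period T t * c \<and> norm (u t) \<le> rho ^ period T t * c"
      using decaying[OF y] by blast
    then show ?thesis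
      unfolding l_def by (rule V_inf_quadratic_le[OF _ _ \<open>T > 0\<close> \<open>0 \<le> rho\<close> \<open>rho < 1\<close>])
  qed
  then show ?thesis
    by blast
qed

end
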